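(* Let $(M_1,J,g_1)$ be an almost Hermitian manifold with fundamental 2-form $\Phi_1$, carrying a 1-form $\omega$ with $d\omega=\Phi_1$, and let $(M_2,\phi,\xi,\eta,g_2)$ be an almost contact metric manifold. Let $\alpha\in\mathbb{R}$, let $f\in C^\infty(M_1,\mathbb{R})$ be positive, and equip $M=M_1\times M_2$ with $\bar\eta(X_1,X_2)=\alpha\,\omega(X_1)+\eta(X_2)$ and the metric $$g\bigl((X_1,X_2),(Y_1,Y_2)\bigr)=g_1(X_1,Y_1)+f^2\bigl(g_2(X_2,Y_2)-\eta(X_2)\eta(Y_2)\bigr)+\bar\eta(X_1,X_2)\,\bar\eta(Y_1,Y_2).$$ Let $\bar\nabla,\tilde\nabla,\nabla$ be the Levi-Civita connections on $M_1$, $M_2$, $M$ respectively. Then for all $X,Y\in\chi(M_1)$ and $U,V,W\in\chi(M_2)$: (i) $$\nabla_{(X,0)}(Y,0)=\Bigl(\bar\nabla_XY-\alpha^2\omega(X)JY-\alpha^2\omega(Y)JX,\ \alpha\bigl(-\omega(\bar\nabla_XY)+\alpha^2\omega(X)\omega(JY)+\alpha^2\omega(Y)\omega(JX)+\tfrac{\lambda}{2}\bigr)\xi\Bigr),$$ where $\lambda=\lambda(X,Y)=X\omega(Y)+Y\omega(X)+\omega([X,Y])$; (ii) $$g\bigl(\nabla_{(X,0)}(0,U),(Y,W)\bigr)=f\,X[f]\,g_2(\phi U,\phi W)+\alpha\,\eta(U)\,d\omega(X,Y)+\alpha\,\omega(X)\,d\eta(U,W);$$ (iii) $$g\bigl(\nabla_{(0,U)}(0,V),(Y,W)\bigr)=f^2g_2(\tilde\nabla_UV,W)+(1-f^2)\eta(V)\,d\eta(U,W)+(1-f^2)\eta(U)\,d\eta(V,W)+\tfrac{\theta}{2}\bar\eta(Y,W)-\tfrac{\theta}{2}f^2\eta(W)-f\,Y[f]\,g_2(\phi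 U,\phi V),$$ where $\theta=\theta(U,V)=U\eta(V)+V\eta(U)+\eta([U,V])$.
   Context: An almost Hermitian manifold $(M_1,J,g_1)$ has $J^2=-\mathrm{id}$ and $g_1(JX,JY)=g_1(X,Y)$; its fundamental 2-form is $\Phi_1(X,Y)=g_1(X,JY)$. The exterior derivative of a 1-form is normalized by $2\,d\eta(X,Y)=X\eta(Y)-Y\eta(X)-\eta([X,Y])$. Vector fields on the product are written $(X_1,X_2)$ with $X_1$ tangent to $M_1$ and $X_2$ tangent to $M_2$; $X[f]$ is the derivative of $f$ along $X$. An almost contact metric manifold $(M_2,\phi,\xi,\eta,g_2)$ is an odd-dimensional manifold with a $(1,1)$-tensor field $\phi$, a vector field $\xi$, a 1-form $\eta$ and a Riemannian metric $g_2$ satisfying $\phi^2U=-U+\eta(U)\xi$, $\eta(\xi)=1$ and $g_2(\phi U,\phi V)=g_2(U,V)-\eta(U)\eta(V)$ for all $U,V\in\chi(M_2)$. *)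

theory Defs
  imports "HOL-Analysis.Analysis"
begin

section \<open>Smooth manifolds\<close>

primrec Ck_on :: "nat \<Rightarrow> 'a::real_normed_vector set \<Rightarrow> ('a \<Rightarrow> 'b::real_normed_vector) \<Rightarrow> bool" where
  "Ck_on 0 S f \<longleftrightarrow> continuous_on S f"
| "Ck_on (Suc k) S f \<longleftrightarrow>
     (\<forall>x\<in>S. f differentiable (at x)) \<and> (\<forall>v. Ck_on k S (\<lambda>x. frechet_derivative f (at x) v))"

text \<open>Only meaningful for open \<open>S\<close>.\<close>

definition smooth_on :: "'a::real_normed_vector set \<Rightarrow> ('a \<Rightarrow> 'b::real_normed_vector) \<Rightarrow> bool" where
  "smooth_on S f \<longleftrightarrow> (\<forall>k. Ck_on k S f)"

text \<open>A chart \<open>(U, c)\<close> consists of an open set \<open>U\<close> and a homeomorphism \<open>c\<close> of \<open>U\<close> onto an open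
  subset of the model space \<open>'e\<close>; values of \<open>c\<close> outside \<open>U\<close> are irrelevant, and its inverse is
  \<open>inv_into U c\<close>. The dimension of the manifold is \<open>DIM('e)\<close>.\<close>

record ('a, 'e) mfd =
  mtop :: "'a topology"
  charts :: "('a set \<times> ('a \<Rightarrow> 'e)) set"

abbreviation points :: "('a, 'e) mfd \<Rightarrow> 'a set" where
  "points M \<equiv> topspace (mtop M)"

definition smooth_manifold :: "('a, 'e::euclidean_space) mfd \<Rightarrow> bool" where
  "smooth_manifold M \<longleftrightarrow>
     Hausdorff_space (mtop M) \<and> second_countable (mtop M) \<and>
     (\<forall>(U, c)\<in>charts M. openin (mtop M) U \<and> open (c ` U) \<and>
        homeomorphic_map (subtopology (mtop M) U) (top_of_set (c ` U)) c) \<and>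
     (\<Union>(U, c)\<in>charts M. U) = points M \<and>
     (\<forall>(U, c)\<in>charts M. \<forall>(V, d)\<in>charts M. smooth_on (c ` (U \<inter> V)) (d \<circ> inv_into U c))"

definition smooth_fun :: "('a, 'e::euclidean_space) mfd \<Rightarrow> ('a \<Rightarrow> real) \<Rightarrow> bool" where
  "smooth_fun M f \<longleftrightarrow> (\<forall>(U, c)\<in>charts M. smooth_on (c ` U) (f \<circ> inv_into U c))"

definition prod_mfd ::
  "('a, 'e::euclidean_space) mfd \<Rightarrow> ('b, 'f::euclidean_space) mfd \<Rightarrow> ('a \<times> 'b, 'e \<times> 'f) mfd" where
  "prod_mfd M N =
     \<lparr>mtop = prod_topology (mtop M) (mtop N),
      charts = {(U \<times> V, map_prod c d) |U c V d. (U, c) \<in> charts M \<and> (V, d) \<in> charts N}\<rparr>"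

section \<open>Tangent vectors and vector fields\<close>

text \<open>Tangent vectors at \<open>p\<close> are derivations at \<open>p\<close> of the algebra of smooth functions. As
  functionals on all functions \<open>'a \<Rightarrow> real\<close> they are made canonical by the value 0 on non-smooth
  functions, so that equality of tangent vectors is equality in the logic. Linear combinations of
  tangent vectors are written out pointwise.\<close>

type_synonym 'a tvec = "('a \<Rightarrow> real) \<Rightarrow> real"
type_synonym 'a vfield = "'a \<Rightarrow> 'a tvec"

definition tangent_space :: "('a, 'e::euclidean_space) mfd \<Rightarrow> 'a \<Rightarrow> 'a tvec set" where
  "tangent_space M p = {v.
     (\<forall>h. \<not> smooth_fun M h \<longrightarrow> v h = 0) \<and>
     (\<forall>h k a b. smooth_fun M h \<longrightarrow> smooth_fun M k \<longrightarrow>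
        v (\<lambda>x. a * h x + b * k x) = a * v h + b * v k) \<and>
     (\<forall>h k. smooth_fun M h \<longrightarrow> smooth_fun M k \<longrightarrow>
        v (\<lambda>x. h x * k x) = h p * v k + k p * v h)}"

definition vector_fields :: "('a, 'e::euclidean_space) mfd \<Rightarrow> 'a vfield set" where
  "vector_fields M = {X. (\<forall>p\<in>points M. X p \<in> tangent_space M p) \<and>
     (\<forall>h. smooth_fun M h \<longrightarrow> smooth_fun M (\<lambda>p. X p h))}"

definition zero_field :: "'a vfield" where
  "zero_field = (\<lambda>p h. 0)"

definition bracket :: "('a, 'e::euclidean_space) mfd \<Rightarrow> 'a vfield \<Rightarrow> 'a vfield \<Rightarrow> 'a vfield" where
  "bracket M X Y = (\<lambda>p h. if smooth_fun M h then X p (\<lambda>x. Y x h) - Y p (\<lambda>x. X x h) else 0)"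

text \<open>The differential of a smooth map \<open>F\<close> into \<open>N\<close>, applied to a tangent vector \<open>v\<close>.\<close>

definition differential :: "('b, 'f::euclidean_space) mfd \<Rightarrow> ('a \<Rightarrow> 'b) \<Rightarrow> 'a tvec \<Rightarrow> 'b tvec" where
  "differential N F v = (\<lambda>h. if smooth_fun N h then v (h \<circ> F) else 0)"

text \<open>For \<open>M\<close> a product manifold and \<open>z = (p, q)\<close>, the pair \<open>(v, w)\<close> with \<open>v\<close> tangent to the first
  factor at \<open>p\<close> and \<open>w\<close> tangent to the second factor at \<open>q\<close>, seen as a tangent vector to the
  product at \<open>z\<close> via the inclusions of the two slices through \<open>z\<close>.\<close>

definition tangent_pair ::
  "('a \<times> 'b, 'e::euclidean_space) mfd \<Rightarrow> 'a \<times> 'b \<Rightarrow> 'a tvec \<Rightarrow> 'b tvec \<Rightarrow> ('a \<times> 'b) tvec" where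
  "tangent_pair M z v w = (\<lambda>h. differential M (\<lambda>x. (x, snd z)) v h + differential M (\<lambda>y. (fst z, y)) w h)"

definition field_pair ::
  "('a \<times> 'b, 'e::euclidean_space) mfd \<Rightarrow> 'a vfield \<Rightarrow> 'b vfield \<Rightarrow> ('a \<times> 'b) vfield" where
  "field_pair M X U = (\<lambda>z. tangent_pair M z (X (fst z)) (U (snd z)))"

section \<open>Tensor fields\<close>

type_synonym 'a form1 = "'a \<Rightarrow> 'a tvec \<Rightarrow> real"
type_synonym 'a form2 = "'a \<Rightarrow> 'a tvec \<Rightarrow> 'a tvec \<Rightarrow> real"
type_synonym 'a endo = "'a \<Rightarrow> 'a tvec \<Rightarrow> 'a tvec"

definition one_form :: "('a, 'e::euclidean_space) mfd \<Rightarrow> 'a form1 \<Rightarrow> bool" where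
  "one_form M \<omega> \<longleftrightarrow>
     (\<forall>p\<in>points M. \<forall>v\<in>tangent_space M p. \<forall>w\<in>tangent_space M p. \<forall>a b.
        \<omega> p (\<lambda>h. a * v h + b * w h) = a * \<omega> p v + b * \<omega> p w) \<and>
     (\<forall>X\<in>vector_fields M. smooth_fun M (\<lambda>p. \<omega> p (X p)))"

text \<open>\<open>(1,1)\<close>-tensor fields, as smooth fields of endomorphisms of the tangent spaces.\<close>

definition endo_field :: "('a, 'e::euclidean_space) mfd \<Rightarrow> 'a endo \<Rightarrow> bool" where
  "endo_field M J \<longleftrightarrow>
     (\<forall>p\<in>points M. \<forall>v\<in>tangent_space M p. J p v \<in> tangent_space M p) \<and>
     (\<forall>p\<in>points M. \<forall>v\<in>tangent_space M p. \<forall>w\<in>tangent_space M p. \<forall>a b.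
        J p (\<lambda>h. a * v h + b * w h) = (\<lambda>h. a * J p v h + b * J p w h)) \<and>
     (\<forall>X\<in>vector_fields M. (\<lambda>p. J p (X p)) \<in> vector_fields M)"

definition riemannian_metric :: "('a, 'e::euclidean_space) mfd \<Rightarrow> 'a form2 \<Rightarrow> bool" where
  "riemannian_metric M g \<longleftrightarrow>
     (\<forall>p\<in>points M. \<forall>u\<in>tangent_space M p. \<forall>v\<in>tangent_space M p. \<forall>w\<in>tangent_space M p. \<forall>a b.
        g p (\<lambda>h. a * u h + b * v h) w = a * g p u w + b * g p v w) \<and>
     (\<forall>p\<in>points M. \<forall>v\<in>tangent_space M p. \<forall>w\<in>tangent_space M p. g p v w = g p w v) \<and>
     (\<forall>p\<in>points M. \<forall>v\<in>tangent_space M p. v \<noteq> (\<lambda>h. 0) \<longrightarrow> g p v v > 0) \<and>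
     (\<forall>X\<in>vector_fields M. \<forall>Y\<in>vector_fields M. smooth_fun M (\<lambda>p. g p (X p) (Y p)))"

text \<open>Exterior derivative of a 1-form, with the normalising factor \<open>1/2\<close>.\<close>

definition ext_deriv ::
  "('a, 'e::euclidean_space) mfd \<Rightarrow> 'a form1 \<Rightarrow> 'a vfield \<Rightarrow> 'a vfield \<Rightarrow> 'a \<Rightarrow> real" where
  "ext_deriv M \<eta> X Y p =
     (X p (\<lambda>x. \<eta> x (Y x)) - Y p (\<lambda>x. \<eta> x (X x)) - \<eta> p (bracket M X Y p)) / 2"

text \<open>The expression \<open>X\<eta>(Y) + Y\<eta>(X) + \<eta>([X,Y])\<close>.\<close>

definition sym_deriv ::
  "('a, 'e::euclidean_space) mfd \<Rightarrow> 'a form1 \<Rightarrow> 'a vfield \<Rightarrow> 'a vfield \<Rightarrow> 'a \<Rightarrow> real" where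
  "sym_deriv M \<eta> X Y p =
     X p (\<lambda>x. \<eta> x (Y x)) + Y p (\<lambda>x. \<eta> x (X x)) + \<eta> p (bracket M X Y p)"

section \<open>The Levi-Civita connection\<close>

type_synonym 'a connection = "'a vfield \<Rightarrow> 'a vfield \<Rightarrow> 'a vfield"

definition affine_connection :: "('a, 'e::euclidean_space) mfd \<Rightarrow> 'a connection \<Rightarrow> bool" where
  "affine_connection M D \<longleftrightarrow>
     (\<forall>X\<in>vector_fields M. \<forall>Y\<in>vector_fields M. D X Y \<in> vector_fields M) \<and>
     (\<forall>X\<in>vector_fields M. \<forall>X'\<in>vector_fields M. \<forall>Y\<in>vector_fields M. \<forall>a b.
        smooth_fun M a \<longrightarrow> smooth_fun M b \<longrightarrow>
        (\<forall>p\<in>points M. D (\<lambda>x h. a x * X x h + b x * X' x h) Y p =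
           (\<lambda>h. a p * D X Y p h + b p * D X' Y p h))) \<and>
     (\<forall>X\<in>vector_fields M. \<forall>Y\<in>vector_fields M. \<forall>Y'\<in>vector_fields M.
        \<forall>p\<in>points M. D X (\<lambda>x h. Y x h + Y' x h) p = (\<lambda>h. D X Y p h + D X Y' p h)) \<and>
     (\<forall>X\<in>vector_fields M. \<forall>Y\<in>vector_fields M. \<forall>a. smooth_fun M a \<longrightarrow>
        (\<forall>p\<in>points M. D X (\<lambda>x h. a x * Y x h) p =
           (\<lambda>h. X p a * Y p h + a p * D X Y p h)))"

definition levi_civita :: "('a, 'e::euclidean_space) mfd \<Rightarrow> 'a form2 \<Rightarrow> 'a connection \<Rightarrow> bool" where
  "levi_civita M g D \<longleftrightarrow>
     affine_connection M D \<and>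
     (\<forall>X\<in>vector_fields M. \<forall>Y\<in>vector_fields M. \<forall>p\<in>points M.
        bracket M X Y p = (\<lambda>h. D X Y p h - D Y X p h)) \<and>
     (\<forall>X\<in>vector_fields M. \<forall>Y\<in>vector_fields M. \<forall>Z\<in>vector_fields M. \<forall>p\<in>points M.
        X p (\<lambda>x. g x (Y x) (Z x)) = g p (D X Y p) (Z p) + g p (Y p) (D X Z p))"

section \<open>Almost Hermitian and almost contact metric manifolds\<close>

definition almost_hermitian ::
  "('a, 'e::euclidean_space) mfd \<Rightarrow> 'a endo \<Rightarrow> 'a form2 \<Rightarrow> bool" where
  "almost_hermitian M J g \<longleftrightarrow>
     smooth_manifold M \<and> endo_field M J \<and> riemannian_metric M g \<and>
     (\<forall>X\<in>vector_fields M. \<forall>p\<in>points M. J p (J p (X p)) = (\<lambda>h. - X p h)) \<and>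
     (\<forall>X\<in>vector_fields M. \<forall>Y\<in>vector_fields M. \<forall>p\<in>points M.
        g p (J p (X p)) (J p (Y p)) = g p (X p) (Y p))"

definition fundamental_form :: "'a endo \<Rightarrow> 'a form2 \<Rightarrow> 'a form2" where
  "fundamental_form J g p v w = g p v (J p w)"

definition almost_contact_metric ::
  "('a, 'e::euclidean_space) mfd \<Rightarrow> 'a endo \<Rightarrow> 'a vfield \<Rightarrow> 'a form1 \<Rightarrow> 'a form2 \<Rightarrow> bool" where
  "almost_contact_metric M \<phi> \<xi> \<eta> g \<longleftrightarrow>
     smooth_manifold M \<and> odd DIM('e) \<and>
     endo_field M \<phi> \<and> \<xi> \<in> vector_fields M \<and> one_form M \<eta> \<and> riemannian_metric M g \<and>
     (\<forall>U\<in>vector_fields M. \<forall>p\<in>points M.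
        \<phi> p (\<phi> p (U p)) = (\<lambda>h. - U p h + \<eta> p (U p) * \<xi> p h)) \<and>
     (\<forall>p\<in>points M. \<eta> p (\<xi> p) = 1) \<and>
     (\<forall>U\<in>vector_fields M. \<forall>V\<in>vector_fields M. \<forall>p\<in>points M.
        g p (\<phi> p (U p)) (\<phi> p (V p)) = g p (U p) (V p) - \<eta> p (U p) * \<eta> p (V p))"

section \<open>The structure on the product\<close>

text \<open>A tangent vector of \<open>M\<^sub>1 \<times> M\<^sub>2\<close> is decomposed into its components by the differentials of the
  two projections.\<close>

definition eta_bar ::
  "('a, 'e::euclidean_space) mfd \<Rightarrow> ('b, 'f::euclidean_space) mfd \<Rightarrow> real \<Rightarrow> 'a form1 \<Rightarrow> 'b form1 \<Rightarrow>
    ('a \<times> 'b) form1" where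
  "eta_bar M1 M2 \<alpha> \<omega> \<eta> z v =
     \<alpha> * \<omega> (fst z) (differential M1 fst v) + \<eta> (snd z) (differential M2 snd v)"

definition product_metric ::
  "('a, 'e::euclidean_space) mfd \<Rightarrow> ('b, 'f::euclidean_space) mfd \<Rightarrow> real \<Rightarrow> ('a \<Rightarrow> real) \<Rightarrow>
    'a form1 \<Rightarrow> 'a form2 \<Rightarrow> 'b form1 \<Rightarrow> 'b form2 \<Rightarrow> ('a \<times> 'b) form2" where
  "product_metric M1 M2 \<alpha> f \<omega> g1 \<eta> g2 z v w =
     g1 (fst z) (differential M1 fst v) (differential M1 fst w)
     + (f (fst z))\<^sup>2 *
         (g2 (snd z) (differential M2 snd v) (differential M2 snd w)
          - \<eta> (snd z) (differential M2 snd v) * \<eta> (snd z) (differential M2 snd w))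
     + eta_bar M1 M2 \<alpha> \<omega> \<eta> z v * eta_bar M1 M2 \<alpha> \<omega> \<eta> z w"

end

theory Submission
  imports Defs
begin

text \<open>On fields of the form \<open>(X, U)\<close> every term of the Koszul formula of the product is a polynomial
  in the corresponding terms of the two factors, because the product metric sees a tangent vector
  only through the differentials of the projections. Subtracting the Koszul formulas of the factors
  leaves exactly the terms with \<open>d\<omega>\<close>, \<open>d\<eta>\<close> and the derivative of \<open>f\<close>, which gives (ii) and (iii).
  For (i) both sides have the same product with every \<open>(Z, W)\<close>, and the product metric is definite:
  a null vector has \<open>v\<^sub>1 = 0\<close>, \<open>\<phi> v\<^sub>2 = 0\<close> and \<open>\<eta>(v\<^sub>2) = 0\<close>, hence is 0.

  Since tangent vectors are derivations, that \<open>(X, U)\<close> is a smooth field, that a tangent vector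
  extends to a field and that \<open>v\<close> is determined by \<open>v\<^sub>1\<close> and \<open>v\<^sub>2\<close> all rest on the coordinate expression
  of a derivation, obtained from Hadamard's lemma and bump functions.\<close>

text \<open>A tangent vector here acts only on globally defined smooth functions, while coordinates
  and the quotients of Hadamard's lemma live on a chart image. Such functions are therefore
  multiplied by a bump function and extended by zero, and it is the Hausdorff property that makes
  the extension smooth: a compact support is then closed in the whole manifold. Functions that agree
  on the carrier may differ elsewhere in the type, so identities that hold only on the carrier enter
  a derivation through \<open>tv_cong\<close> and not by rewriting. Pairs of fields are enough as
  test fields because each claim concerns a single point, where the values of pairs exhaust the
  tangent space. The factor 1/2 in \<open>ext_deriv\<close> absorbs the factor 2 of the Koszul
  formula. When the products of \<open>eta_bar\<close> in that formula are expanded, the derivatives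
  and brackets of \<omega> and \<eta> form two kinds of groups: with minus signs they are twice an
  exterior derivative, with plus signs they are \<lambda> or \<theta>.\<close>

section \<open>Smooth functions on Euclidean space\<close>

text \<open>Openness of \<open>S\<close> carries this: \<open>Ck_on\<close> takes derivatives at a
  point of the whole space, and agreement on a set that is not open would not determine
  them.\<close>

lemma Ck_on_cong:
  assumes "open S" "\<And>x. x \<in> S \<Longrightarrow> f x = g x" "Ck_on k S f"
  shows "Ck_on k S g"
  using assms
proof (induction k arbitrary: f g)
  case 0
  then show ?case using continuous_on_cong[of S S f g] by simp
next
  case (Suc k)
  have d: "g differentiable (at x)" if "x \<in> S" for x
    using Suc.prems that has_derivative_transform_within_open[of f _ x UNIV S g]
    unfolding differentiable_def by (metis Ck_on.simps(2) differentiable_def)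
  have e: "frechet_derivative f (at x) = frechet_derivative g (at x)" if "x \<in> S" for x
    using Suc.prems that by (intro frechet_derivative_transform_within_open[of f x S g]) auto
  have "Ck_on k S (\<lambda>x. frechet_derivative g (at x) v)" for v
    by (rule Suc.IH[of "\<lambda>x. frechet_derivative f (at x) v"]) (use Suc.prems e in auto)
  with d show ?case by simp
qed

lemma Ck_on_subset: "Ck_on k S f \<Longrightarrow> T \<subseteq> S \<Longrightarrow> Ck_on k T f"
  by (induction k arbitrary: f) (auto intro: continuous_on_subset)

lemma Ck_on_local:
  assumes "\<And>x. x \<in> S \<Longrightarrow> \<exists>T. open T \<and> x \<in> T \<and> Ck_on k T f"
  shows "Ck_on k S f"
  using assms
proof (induction k arbitrary: f)
  case 0
  show ?case
  proof (simp add: continuous_on_eq_continuous_within, intro ballI)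
    fix x assume "x \<in> S"
    then obtain T where "open T" "x \<in> T" "continuous_on T f" using 0 by auto
    then show "continuous (at x within S) f"
      by (metis continuous_at_imp_continuous_within continuous_on_eq_continuous_at)
  qed
next
  case (Suc k)
  have "f differentiable (at x)" if "x \<in> S" for x
    using Suc.prems[OF that] by auto
  moreover have "Ck_on k S (\<lambda>x. frechet_derivative f (at x) v)" for v
    by (rule Suc.IH) (use Suc.prems in fastforce)
  ultimately show ?case by simp
qed

text \<open>Admits a closed-form derivative in place of \<open>frechet_derivative\<close>; the
  product, chain and inverse rules below supply their derivatives through it.\<close>

lemma Ck_on_SucI:
  assumes "open S" "\<And>x. x \<in> S \<Longrightarrow> (f has_derivative f' x) (at x)" "\<And>v. Ck_on k S (\<lambda>x. f' x v)"
  shows "Ck_on (Suc k) S f"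
proof -
  have "Ck_on k S (\<lambda>x. frechet_derivative f (at x) v)" for v
    by (rule Ck_on_cong[OF assms(1) _ assms(3)[of v]]) (metis assms(2) frechet_derivative_at)
  then show ?thesis using assms(2) by (auto simp: differentiable_def)
qed

lemma Ck_on_SucD:
  "Ck_on (Suc k) S f \<Longrightarrow> x \<in> S \<Longrightarrow> (f has_derivative frechet_derivative f (at x)) (at x)"
  by (simp add: frechet_derivative_works)

text \<open>The successor clause does not mention continuity, so the descent rests on
  differentiability at the bottom and on the derivatives at higher orders.\<close>

lemma Ck_on_Suc_imp: "Ck_on (Suc k) S f \<Longrightarrow> Ck_on k S f"
proof (induction k arbitrary: f)
  case 0
  then show ?case
    by (auto intro!: continuous_at_imp_continuous_on differentiable_imp_continuous_within)
next
  case (Suc k)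
  then show ?case by (metis Ck_on.simps(2))
qed

lemma Ck_on_const: "Ck_on k S (\<lambda>x. c)"
  by (induction k arbitrary: c) auto

lemma Ck_on_bounded_linear:
  assumes "open S" "bounded_linear L" "Ck_on k S f"
  shows "Ck_on k S (\<lambda>x. L (f x))"
  using assms(3)
proof (induction k arbitrary: f)
  case 0
  then show ?case by (simp add: bounded_linear.continuous_on[OF assms(2)])
next
  case (Suc k)
  show ?case
    by (rule Ck_on_SucI[OF assms(1), where f'="\<lambda>x v. L (frechet_derivative f (at x) v)"])
       (use Suc Ck_on_SucD[OF Suc.prems] in \<open>auto intro!: bounded_linear.has_derivative[OF assms(2)]\<close>)
qed

lemma Ck_on_add:
  assumes "open S" "Ck_on k S f" "Ck_on k S g"
  shows "Ck_on k S (\<lambda>x. f x + g x)"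
  using assms(2,3)
proof (induction k arbitrary: f g)
  case 0
  then show ?case by (simp add: continuous_on_add)
next
  case (Suc k)
  show ?case
    by (rule Ck_on_SucI[OF assms(1), where
          f'="\<lambda>x v. frechet_derivative f (at x) v + frechet_derivative g (at x) v"])
       (use Suc Ck_on_SucD[OF Suc.prems(1)] Ck_on_SucD[OF Suc.prems(2)] in
         \<open>auto intro!: has_derivative_add\<close>)
qed

lemma Ck_on_sum:
  assumes "open S" "\<And>i. i \<in> I \<Longrightarrow> Ck_on k S (f i)"
  shows "Ck_on k S (\<lambda>x. \<Sum>i\<in>I. f i x)"
  using assms(2)
  by (induction I rule: infinite_finite_induct) (auto intro!: Ck_on_const Ck_on_add assms(1))

text \<open>The Leibniz rule leaves one factor undifferentiated, hence the descent by
  \<open>Ck_on_Suc_imp\<close> before the induction hypothesis applies.\<close>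

lemma Ck_on_bilinear:
  assumes "open S" "bounded_bilinear B" "Ck_on k S f" "Ck_on k S g"
  shows "Ck_on k S (\<lambda>x. B (f x) (g x))"
  using assms(3,4)
proof (induction k arbitrary: f g)
  case 0
  then show ?case by (simp add: bounded_bilinear.continuous_on[OF assms(2)])
next
  case (Suc k)
  have "Ck_on k S (\<lambda>x. B (f x) (frechet_derivative g (at x) v) + B (frechet_derivative f (at x) v) (g x))" for v
    using Suc Ck_on_Suc_imp[OF Suc.prems(1)] Ck_on_Suc_imp[OF Suc.prems(2)]
    by (intro Ck_on_add assms(1)) auto
  then show ?case
    by (intro Ck_on_SucI[OF assms(1), where
          f'="\<lambda>x v. B (f x) (frechet_derivative g (at x) v) + B (frechet_derivative f (at x) v) (g x)"]
          bounded_bilinear.FDERIV[OF assms(2)])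
       (use Ck_on_SucD[OF Suc.prems(1)] Ck_on_SucD[OF Suc.prems(2)] in auto)
qed

text \<open>The chain rule evaluates the derivative of \<open>f\<close> at a moving point in a
  moving direction, but \<open>Ck_on\<close> speaks only of fixed directions. Expanding the
  direction in the basis of the intermediate space restores fixed directions at the price of scalar
  coefficients; this is why that space is Euclidean.\<close>

lemma Ck_on_compose:
  fixes g :: "'a::real_normed_vector \<Rightarrow> 'b::euclidean_space"
  assumes "open S" "open T" "Ck_on k T f" "Ck_on k S g" "g ` S \<subseteq> T"
  shows "Ck_on k S (\<lambda>x. f (g x))"
  using assms(3,4)
proof (induction k arbitrary: f)
  case 0
  then show ?case using continuous_on_compose2 assms(5) by fastforce
next
  case (Suc k)
  let ?D = "\<lambda>x v. frechet_derivative f (at (g x)) (frechet_derivative g (at x) v)"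
  have Df: "(f has_derivative frechet_derivative f (at y)) (at y)" if "y \<in> T" for y
    using Ck_on_SucD[OF Suc.prems(1)] that .
  have "Ck_on k S (\<lambda>x. \<Sum>b\<in>Basis. (frechet_derivative g (at x) v \<bullet> b) *\<^sub>R frechet_derivative f (at (g x)) b)" for v
    by (intro Ck_on_sum Ck_on_bilinear[OF assms(1) bounded_bilinear_scaleR] assms(1)
        Ck_on_bounded_linear[OF assms(1) bounded_linear_inner_left])
      (use Suc Ck_on_Suc_imp[OF Suc.prems(2)] in auto)
  moreover have "(\<Sum>b\<in>Basis. (frechet_derivative g (at x) v \<bullet> b) *\<^sub>R frechet_derivative f (at (g x)) b) = ?D x v"
    if "x \<in> S" for x v
  proof -
    have "linear (frechet_derivative f (at (g x)))"
      using Df[of "g x"] that assms(5) has_derivative_linear by blast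
    then show ?thesis
      by (subst (2) euclidean_representation[symmetric])
        (simp add: linear_sum linear_scale del: euclidean_representation)
  qed
  ultimately have "Ck_on k S (\<lambda>x. ?D x v)" for v
    using Ck_on_cong[OF assms(1)] by (metis (no_types, lifting))
  moreover have "((\<lambda>x. f (g x)) has_derivative ?D x) (at x)" if "x \<in> S" for x
    using has_derivative_compose[OF Ck_on_SucD[OF Suc.prems(2) that] Df] that assms(5) by blast
  ultimately show ?case
    by (intro Ck_on_SucI[OF assms(1)]) auto
qed

lemma Ck_on_ident: "open S \<Longrightarrow> Ck_on k S (\<lambda>x. x)"
proof (cases k)
  case (Suc m)
  show "open S \<Longrightarrow> ?thesis" unfolding Suc
    by (rule Ck_on_SucI[where f'="\<lambda>x v. v"]) (auto intro: Ck_on_const)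
qed simp

lemma Ck_on_Pair:
  assumes "open S" "Ck_on k S f" "Ck_on k S g"
  shows "Ck_on k S (\<lambda>x. (f x, g x))"
proof -
  have "Ck_on k S (\<lambda>x. (f x, 0) + (0, g x))"
    by (intro Ck_on_add assms
        Ck_on_bounded_linear[OF assms(1) _ assms(2), of "\<lambda>y. (y, 0)"]
        Ck_on_bounded_linear[OF assms(1) _ assms(3), of "\<lambda>y. (0, y)"])
      (auto intro: bounded_linear_Pair bounded_linear_ident bounded_linear_zero)
  then show ?thesis by simp
qed

text \<open>The derivative contains \<open>inverse (f x)\<close> again, so the induction runs over
  the order alone, with \<open>f\<close> fixed, and feeds its own hypothesis back.\<close>

lemma Ck_on_inverse:
  fixes f :: "'a::real_normed_vector \<Rightarrow> real"
  assumes "open S" "Ck_on k S f" "\<And>x. x \<in> S \<Longrightarrow> f x \<noteq> 0"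
  shows "Ck_on k S (\<lambda>x. inverse (f x))"
  using assms(2,3)
proof (induction k)
  case 0
  then show ?case by (auto intro: continuous_on_inverse)
next
  case (Suc k)
  have "Ck_on k S (\<lambda>x. inverse (f x))" using Suc Ck_on_Suc_imp by blast
  then have "Ck_on k S (\<lambda>x. - (inverse (f x) * frechet_derivative f (at x) v * inverse (f x)))" for v
    by (intro Ck_on_bounded_linear[OF assms(1) bounded_linear_minus[OF bounded_linear_ident]]
        Ck_on_bilinear[OF assms(1) bounded_bilinear_mult]) (use Suc in auto)
  then show ?case
    by (intro Ck_on_SucI[OF assms(1), where
          f'="\<lambda>x v. - (inverse (f x) * frechet_derivative f (at x) v * inverse (f x))"])
      (use Suc Ck_on_SucD[OF Suc.prems(1)] in \<open>auto intro!: has_derivative_inverse\<close>)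
qed

lemma smooth_on_cong:
  "open S \<Longrightarrow> (\<And>x. x \<in> S \<Longrightarrow> f x = g x) \<Longrightarrow> smooth_on S f \<Longrightarrow> smooth_on S g"
  unfolding smooth_on_def using Ck_on_cong by blast

lemma smooth_on_subset: "smooth_on S f \<Longrightarrow> T \<subseteq> S \<Longrightarrow> smooth_on T f"
  unfolding smooth_on_def using Ck_on_subset by blast

lemma smooth_on_local:
  assumes "\<And>x. x \<in> S \<Longrightarrow> \<exists>T. open T \<and> x \<in> T \<and> smooth_on T f"
  shows "smooth_on S f"
  unfolding smooth_on_def using assms Ck_on_local[of S _ f] unfolding smooth_on_def by metis

lemma smooth_on_const: "smooth_on S (\<lambda>x. c)"
  by (simp add: smooth_on_def Ck_on_const)

lemma smooth_on_ident: "open S \<Longrightarrow> smooth_on S (\<lambda>x. x)"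
  by (simp add: smooth_on_def Ck_on_ident)

lemma smooth_on_bounded_linear:
  "open S \<Longrightarrow> bounded_linear L \<Longrightarrow> smooth_on S f \<Longrightarrow> smooth_on S (\<lambda>x. L (f x))"
  by (simp add: smooth_on_def Ck_on_bounded_linear)

lemma smooth_on_linear: "open S \<Longrightarrow> bounded_linear L \<Longrightarrow> smooth_on S L"
  using smooth_on_bounded_linear[OF _ _ smooth_on_ident] by blast

lemma smooth_on_add:
  "open S \<Longrightarrow> smooth_on S f \<Longrightarrow> smooth_on S g \<Longrightarrow> smooth_on S (\<lambda>x. f x + g x)"
  by (simp add: smooth_on_def Ck_on_add)

lemma smooth_on_sum:
  "open S \<Longrightarrow> (\<And>i. i \<in> I \<Longrightarrow> smooth_on S (f i)) \<Longrightarrow> smooth_on S (\<lambda>x. \<Sum>i\<in>I. f i x)"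
  by (simp add: smooth_on_def Ck_on_sum)

lemma smooth_on_scaleR:
  "open S \<Longrightarrow> smooth_on S f \<Longrightarrow> smooth_on S g \<Longrightarrow> smooth_on S (\<lambda>x. f x *\<^sub>R g x)"
  by (simp add: smooth_on_def Ck_on_bilinear[OF _ bounded_bilinear_scaleR])

lemma smooth_on_mult:
  fixes f g :: "_ \<Rightarrow> real"
  shows "open S \<Longrightarrow> smooth_on S f \<Longrightarrow> smooth_on S g \<Longrightarrow> smooth_on S (\<lambda>x. f x * g x)"
  using smooth_on_scaleR[of S f g] by simp

lemma smooth_on_inner:
  "open S \<Longrightarrow> smooth_on S f \<Longrightarrow> smooth_on S g \<Longrightarrow> smooth_on S (\<lambda>x. f x \<bullet> g x)"
  by (simp add: smooth_on_def Ck_on_bilinear[OF _ bounded_bilinear_inner])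

lemma smooth_on_inverse:
  fixes f :: "_ \<Rightarrow> real"
  shows "open S \<Longrightarrow> smooth_on S f \<Longrightarrow> (\<And>x. x \<in> S \<Longrightarrow> f x \<noteq> 0) \<Longrightarrow> smooth_on S (\<lambda>x. inverse (f x))"
  by (simp add: smooth_on_def Ck_on_inverse)

lemma smooth_on_Pair:
  "open S \<Longrightarrow> smooth_on S f \<Longrightarrow> smooth_on S g \<Longrightarrow> smooth_on S (\<lambda>x. (f x, g x))"
  by (simp add: smooth_on_def Ck_on_Pair)

lemma smooth_on_compose:
  fixes g :: "'a::real_normed_vector \<Rightarrow> 'b::euclidean_space"
  shows "smooth_on T f \<Longrightarrow> open S \<Longrightarrow> open T \<Longrightarrow> smooth_on S g \<Longrightarrow> (\<And>x. x \<in> S \<Longrightarrow> g x \<in> T) \<Longrightarrow>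
    smooth_on S (\<lambda>x. f (g x))"
  unfolding smooth_on_def using Ck_on_compose[of S T _ f g] by blast

lemma smooth_on_differentiable: "smooth_on S f \<Longrightarrow> x \<in> S \<Longrightarrow> f differentiable (at x)"
  unfolding smooth_on_def using Ck_on.simps(2) by blast

lemma smooth_on_has_derivative:
  "smooth_on S f \<Longrightarrow> x \<in> S \<Longrightarrow> (f has_derivative frechet_derivative f (at x)) (at x)"
  using smooth_on_differentiable frechet_derivative_works by blast

lemma smooth_on_continuous_on: "smooth_on S f \<Longrightarrow> continuous_on S f"
  unfolding smooth_on_def using Ck_on.simps(1) by blast

lemma smooth_on_frechet_derivative:
  "smooth_on S f \<Longrightarrow> smooth_on S (\<lambda>x. frechet_derivative f (at x) v)"
  unfolding smooth_on_def using Ck_on.simps(2) by blast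

lemma Ck_on_continuous_on: "Ck_on k S f \<Longrightarrow> continuous_on S f"
  by (induction k) (simp, metis Ck_on_Suc_imp)

text \<open>The weight \<open>t ^ m\<close> makes the induction work: each derivative in \<open>x\<close> produces a factor \<open>t\<close>.\<close>

lemma Ck_on_integral:
  fixes K :: "'a::euclidean_space \<Rightarrow> real"
  assumes "open S" "convex S" "a \<in> S" "Ck_on k S K"
  shows "Ck_on k S (\<lambda>x. integral (cbox 0 1) (\<lambda>t. t ^ m * K (a + t *\<^sub>R (x - a))))"
  using assms(4)
proof (induction k arbitrary: K m)
  case 0
  have mem: "a + t *\<^sub>R (x - a) \<in> S" if "x \<in> S" "t \<in> cbox 0 1" for x t
    using convexD_alt[OF assms(2,3) that(1), of t] that(2) by (simp add: algebra_simps)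
  have "continuous_on (S \<times> cbox 0 1) (\<lambda>(x, t). t ^ m * K (a + t *\<^sub>R (x - a)))"
    unfolding case_prod_beta
    by (intro continuous_intros continuous_on_compose2[OF 0[simplified]]) (use mem in auto)
  then show ?case
    unfolding Ck_on.simps by (rule integral_continuous_on_param)
next
  case (Suc k)
  have mem: "a + t *\<^sub>R (x - a) \<in> S" if "x \<in> S" "t \<in> cbox 0 1" for x t
    using convexD_alt[OF assms(2,3) that(1), of t] that(2) by (simp add: algebra_simps)
  let ?D = "\<lambda>y. frechet_derivative K (at y)"
  have D: "(K has_derivative ?D y) (at y)" if "y \<in> S" for y
    using Ck_on_SucD[OF Suc.prems that] .
  \<comment> \<open>\<open>leibniz_rule\<close> asks for the derivative as a continuous family of
    bounded linear maps, hence \<open>Blinfun\<close>; in finite dimension its continuity can be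
    checked on single vectors.\<close>
  define fx where "fx x t = t ^ Suc m *\<^sub>R Blinfun (?D (a + t *\<^sub>R (x - a)))" for x t
  have fx: "blinfun_apply (fx x t) v = t ^ Suc m * ?D (a + t *\<^sub>R (x - a)) v"
    if "x \<in> S" "t \<in> cbox 0 1" for x t v
    using bounded_linear_Blinfun_apply[OF has_derivative_bounded_linear[OF D[OF mem[OF that]]]]
    by (simp add: fx_def scaleR_blinfun.rep_eq)
  have cK: "continuous_on S K"
    using Suc.prems by (rule Ck_on_continuous_on)
  have cD: "continuous_on S (\<lambda>y. ?D y v)" for v
    using Suc.prems by (intro Ck_on_continuous_on[of k]) simp
  have contD: "continuous_on (S \<times> cbox 0 1) (\<lambda>z. snd z ^ j * ?D (a + snd z *\<^sub>R (fst z - a)) v)" for v j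
    by (intro continuous_intros continuous_on_compose2[OF cD]) (use mem in auto)
  have cont: "continuous_on (S \<times> cbox 0 1) (\<lambda>(x, t). fx x t)"
    unfolding case_prod_beta
  proof (rule continuous_on_blinfun_componentwise)
    fix i :: 'a
    show "continuous_on (S \<times> cbox 0 1) (\<lambda>z. blinfun_apply (fx (fst z) (snd z)) i)"
      by (rule continuous_on_eq[OF contD[of "Suc m" i]]) (use fx in auto)
  qed
  have int: "(\<lambda>t. t ^ m * K (a + t *\<^sub>R (x - a))) integrable_on cbox 0 1" if "x \<in> S" for x
    by (intro integrable_continuous continuous_intros continuous_on_compose2[OF cK])
      (use mem that in auto)
  have der: "((\<lambda>x. t ^ m * K (a + t *\<^sub>R (x - a))) has_derivative blinfun_apply (fx x t)) (at x within S)"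
    if "x \<in> S" "t \<in> cbox 0 1" for x t
  proof -
    have lin: "linear (?D (a + t *\<^sub>R (x - a)))"
      using D[OF mem[OF that]] has_derivative_linear by blast
    have "((\<lambda>x. a + t *\<^sub>R (x - a)) has_derivative (\<lambda>v. t *\<^sub>R v)) (at x within S)"
      by (auto intro!: derivative_eq_intros)
    from has_derivative_compose[OF this D[OF mem[OF that]]]
    have "((\<lambda>x. t ^ m * K (a + t *\<^sub>R (x - a))) has_derivative
        (\<lambda>v. t ^ m * ?D (a + t *\<^sub>R (x - a)) (t *\<^sub>R v))) (at x within S)"
      by (rule has_derivative_mult_right)
    moreover have "(\<lambda>v. t ^ m * ?D (a + t *\<^sub>R (x - a)) (t *\<^sub>R v)) = blinfun_apply (fx x t)"
      by (rule ext) (simp add: fx[OF that] linear_scale[OF lin])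
    ultimately show ?thesis by simp
  qed
  have L: "((\<lambda>x. integral (cbox 0 1) (\<lambda>t. t ^ m * K (a + t *\<^sub>R (x - a))))
      has_derivative blinfun_apply (integral (cbox 0 1) (fx x))) (at x)" if "x \<in> S" for x
    using leibniz_rule[where f="\<lambda>x t. t ^ m * K (a + t *\<^sub>R (x - a))", OF der int cont that assms(2)]
    by (simp add: at_within_open[OF that assms(1)])
  have E: "blinfun_apply (integral (cbox 0 1) (fx x)) v =
      integral (cbox 0 1) (\<lambda>t. t ^ Suc m * ?D (a + t *\<^sub>R (x - a)) v)" if "x \<in> S" for x v
  proof -
    have "continuous_on (cbox 0 1) (\<lambda>t. (\<lambda>(x, t). fx x t) (x, t))"
      by (rule continuous_on_compose2[OF cont]) (use that in \<open>auto intro!: continuous_intros\<close>)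
    then have "fx x integrable_on cbox 0 1"
      by (intro integrable_continuous) simp
    from integral_linear[OF this blinfun.bounded_linear_left, of v]
    have "blinfun_apply (integral (cbox 0 1) (fx x)) v = integral (cbox 0 1) (\<lambda>t. blinfun_apply (fx x t) v)"
      by (simp add: o_def)
    also have "\<dots> = integral (cbox 0 1) (\<lambda>t. t ^ Suc m * ?D (a + t *\<^sub>R (x - a)) v)"
      using fx[OF that] by (rule integral_cong)
    finally show ?thesis .
  qed
  have I: "Ck_on k S (\<lambda>x. integral (cbox 0 1) (\<lambda>t. t ^ Suc m * ?D (a + t *\<^sub>R (x - a)) v))" for v
    by (rule Suc.IH) (use Suc.prems in auto)
  show ?case
    by (rule Ck_on_SucI[OF assms(1) L Ck_on_cong[OF assms(1) E[symmetric] I]])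
qed

text \<open>\<open>G b\<close> is the average of the partial derivative of \<open>H\<close> along
  the segment from \<open>a\<close> to \<open>x\<close>. The fundamental theorem of calculus gives
  the expansion, convexity keeps the segment inside \<open>S\<close>, and at \<open>x = a\<close> a
  constant is averaged. Smoothness of \<open>G b\<close> is \<open>Ck_on_integral\<close> with
  weight \<open>t ^ 0\<close>.\<close>

lemma hadamard:
  fixes H :: "'a::euclidean_space \<Rightarrow> real"
  assumes "open S" "convex S" "a \<in> S" "smooth_on S H"
  obtains G where "\<And>b. smooth_on S (G b)"
    "\<And>b. G b a = frechet_derivative H (at a) b"
    "\<And>x. x \<in> S \<Longrightarrow> H x = H a + (\<Sum>b\<in>Basis. ((x - a) \<bullet> b) * G b x)"
proof
  let ?D = "\<lambda>y. frechet_derivative H (at y)"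
  define G where "G b x = integral (cbox 0 1) (\<lambda>t. t ^ 0 * ?D (a + t *\<^sub>R (x - a)) b)" for b x
  show "smooth_on S (G b)" for b
    using assms Ck_on_integral[OF assms(1-3)] smooth_on_frechet_derivative[OF assms(4)]
    unfolding smooth_on_def G_def by blast
  show "G b a = ?D a b" for b
    by (simp add: G_def)
  fix x assume x: "x \<in> S"
  have mem: "a + t *\<^sub>R (x - a) \<in> S" if "t \<in> cbox 0 1" for t
    using convexD_alt[OF assms(2,3) x, of t] that by (simp add: algebra_simps)
  have D: "(H has_derivative ?D y) (at y)" if "y \<in> S" for y
    using smooth_on_has_derivative[OF assms(4) that] .
  have "((\<lambda>t. H (a + t *\<^sub>R (x - a))) has_vector_derivative ?D (a + t *\<^sub>R (x - a)) (x - a))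
      (at t within cbox 0 1)" if "t \<in> cbox 0 1" for t
  proof -
    have "((\<lambda>t. a + t *\<^sub>R (x - a)) has_derivative (\<lambda>s. s *\<^sub>R (x - a))) (at t within cbox 0 1)"
      by (auto intro!: derivative_eq_intros)
    from has_derivative_compose[OF this D[OF mem[OF that]]] show ?thesis
      unfolding has_vector_derivative_def
      by (simp add: linear_scale[OF has_derivative_linear[OF D[OF mem[OF that]]]])
  qed
  then have 1: "((\<lambda>t. ?D (a + t *\<^sub>R (x - a)) (x - a)) has_integral
      (H (a + 1 *\<^sub>R (x - a)) - H (a + 0 *\<^sub>R (x - a)))) {0..1}"
    by (intro fundamental_theorem_of_calculus) auto
  have "?D y (x - a) = (\<Sum>b\<in>Basis. ((x - a) \<bullet> b) * ?D y b)" if "y \<in> S" for y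
    using has_derivative_linear[OF D[OF that]]
    by (subst euclidean_representation[of "x - a", symmetric])
      (simp add: linear_sum linear_scale del: euclidean_representation)
  then have 2: "((\<lambda>t. (\<Sum>b\<in>Basis. ((x - a) \<bullet> b) * ?D (a + t *\<^sub>R (x - a)) b)) has_integral
      (H x - H a)) (cbox 0 1)"
    using 1 mem by (subst has_integral_cong[symmetric, where
          f="\<lambda>t. ?D (a + t *\<^sub>R (x - a)) (x - a)"]) auto
  have cD: "continuous_on S (\<lambda>y. ?D y b)" for b
    using smooth_on_continuous_on smooth_on_frechet_derivative[OF assms(4)] by blast
  have "(\<lambda>t. ?D (a + t *\<^sub>R (x - a)) b) integrable_on cbox 0 1" for b
    by (intro integrable_continuous continuous_intros continuous_on_compose2[OF cD]) (use mem in auto)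
  then have "((\<lambda>t. (\<Sum>b\<in>Basis. ((x - a) \<bullet> b) * ?D (a + t *\<^sub>R (x - a)) b)) has_integral
      (\<Sum>b\<in>Basis. ((x - a) \<bullet> b) * G b x)) (cbox 0 1)"
    unfolding G_def by (intro has_integral_sum has_integral_mult_right) auto
  with 2 have "H x - H a = (\<Sum>b\<in>Basis. ((x - a) \<bullet> b) * G b x)"
    using has_integral_unique by blast
  then show "H x = H a + (\<Sum>b\<in>Basis. ((x - a) \<bullet> b) * G b x)" by simp
qed

section \<open>Flat functions and bump functions\<close>

text \<open>The classical function exp(-1/t) is the case \<open>p = 1\<close>. Admitting a
  polynomial in 1/t makes the family closed under differentiation, so that smoothness of all members
  is a single induction over the order.\<close>

definition flat :: "real poly \<Rightarrow> real \<Rightarrow> real" where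
  "flat p t = (if 0 < t then poly p (inverse t) * exp (- inverse t) else 0)"

lemma poly_mult_exp_tendsto_0: "((\<lambda>x::real. poly p x * exp (- x)) \<longlongrightarrow> 0) at_top"
proof -
  have "((\<lambda>x::real. \<Sum>i\<le>degree p. coeff p i * (x ^ i / exp x)) \<longlongrightarrow> (\<Sum>i\<le>degree p. coeff p i * 0)) at_top"
    by (intro tendsto_intros tendsto_power_div_exp_0)
  then show ?thesis
    by (simp add: poly_altdef exp_minus field_simps sum_divide_distrib sum_distrib_left)
qed

lemma flat_has_derivative:
  "(flat p has_real_derivative flat ([:0, 0, 1:] * (p - pderiv p)) t) (at t)"
proof -
  consider "t < 0" | "t > 0" | "t = 0" by linarith
  then show ?thesis
  proof cases
    case 1
    have "((\<lambda>_. 0) has_real_derivative 0) (at t)" by simp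
    then have "(flat p has_real_derivative 0) (at t)"
      by (rule has_field_derivative_transform_within_open[where S="{..<0}"])
        (use 1 in \<open>auto simp: flat_def\<close>)
    then show ?thesis using 1 by (simp add: flat_def)
  next
    case 2
    have "((\<lambda>t. poly p (inverse t) * exp (- inverse t)) has_real_derivative
        flat ([:0, 0, 1:] * (p - pderiv p)) t) (at t)"
      using 2 by (auto intro!: derivative_eq_intros
          simp: flat_def power2_eq_square field_simps)
    then show ?thesis
      by (rule has_field_derivative_transform_within_open[where S="{0<..}"])
        (use 2 in \<open>auto simp: flat_def\<close>)
  next
    case 3
    \<comment> \<open>For \<open>h > 0\<close>, dividing \<open>flat p h\<close> by \<open>h\<close>
      multiplies the polynomial by its variable, so the difference quotient at 0 is again a
      polynomial in 1/h against an exponential.\<close>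
    have "((\<lambda>h. poly (pCons 0 p) (inverse h) * exp (- inverse h)) \<longlongrightarrow> 0) (at_right 0)"
      by (rule filterlim_compose[OF poly_mult_exp_tendsto_0 filterlim_inverse_at_top_right])
    then have "((\<lambda>h. flat p h / h) \<longlongrightarrow> 0) (at_right 0)"
      by (rule Lim_transform_eventually)
        (auto simp: eventually_at_filter flat_def field_simps)
    moreover have "((\<lambda>h. flat p h / h) \<longlongrightarrow> 0) (at_left 0)"
      by (rule Lim_transform_eventually[where f="\<lambda>_. 0"])
        (auto simp: eventually_at_filter flat_def)
    ultimately have "((\<lambda>h. flat p h / h) \<longlongrightarrow> 0) (at 0)"
      by (simp add: filterlim_split_at)
    then show ?thesis
      unfolding 3 by (simp add: DERIV_def flat_def)
  qed
qed

lemma smooth_on_flat: "smooth_on UNIV (flat p)"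
  unfolding smooth_on_def
proof
  fix k show "Ck_on k UNIV (flat p)"
  proof (induction k arbitrary: p)
    case 0
    then show ?case
      using flat_has_derivative DERIV_isCont continuous_at_imp_continuous_on by (metis Ck_on.simps(1))
  next
    case (Suc k)
    show ?case
      by (rule Ck_on_SucI[where f'="\<lambda>t v. flat ([:0, 0, 1:] * (p - pderiv p)) t * v"])
        (auto intro!: Ck_on_bounded_linear[OF _ bounded_linear_mult_left] Suc
          simp del: mult_pCons_left simp: flat_has_derivative[unfolded has_field_derivative_def])
  qed
qed

text \<open>The usual quotient N/(N + M), with N positive exactly inside the ball of radius
  \<open>R\<close> and M positive exactly outside the closed ball of radius \<open>R / 2\<close>;
  these regions cover the space, so the denominator never vanishes. The squared distance is used
  because it is smooth at \<open>a\<close> too.\<close>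

lemma bump_exists:
  fixes a :: "'a::euclidean_space"
  assumes "R > 0"
  obtains \<beta> :: "'a \<Rightarrow> real" where "smooth_on UNIV \<beta>" "\<And>x. x \<in> ball a (R / 2) \<Longrightarrow> \<beta> x = 1"
    "\<And>x. x \<notin> ball a R \<Longrightarrow> \<beta> x = 0"
proof
  define d where "d x = (x - a) \<bullet> (x - a)" for x
  define s where "s = flat 1"
  have s: "s t = 0" if "t \<le> 0" for t using that by (simp add: s_def flat_def)
  have s_pos: "s t > 0" if "t > 0" for t using that by (simp add: s_def flat_def)
  have s_nn: "s t \<ge> 0" for t by (simp add: s_def flat_def)
  have d: "d x = (dist a x)\<^sup>2" for x
    by (simp add: d_def dist_norm norm_minus_commute[of a] power2_norm_eq_inner)
  let ?N = "\<lambda>x. s (R\<^sup>2 + - d x)" and ?M = "\<lambda>x. s (d x + - (R / 2)\<^sup>2)"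
  define \<beta> where "\<beta> x = ?N x * inverse (?N x + ?M x)" for x
  have pos: "?N x + ?M x > 0" for x
  proof (cases "d x < R\<^sup>2")
    case True
    then show ?thesis using s_pos[of "R\<^sup>2 + - d x"] s_nn[of "d x + - (R / 2)\<^sup>2"] by simp
  next
    case False
    moreover have "(R / 2)\<^sup>2 < R\<^sup>2" using assms by (simp add: power2_eq_square)
    ultimately show ?thesis using s_pos[of "d x + - (R / 2)\<^sup>2"] s_nn[of "R\<^sup>2 + - d x"] by simp
  qed
  have sub: "smooth_on UNIV (\<lambda>x. x - a)"
    using smooth_on_add[OF open_UNIV smooth_on_ident[OF open_UNIV] smooth_on_const[of _ "- a"]] by simp
  have sd: "smooth_on UNIV d"
    unfolding d_def by (intro smooth_on_inner sub open_UNIV)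
  have ss: "smooth_on UNIV s" unfolding s_def by (rule smooth_on_flat)
  have N: "smooth_on UNIV ?N"
    by (intro smooth_on_compose[OF ss] smooth_on_add smooth_on_const
        smooth_on_bounded_linear[OF _ bounded_linear_minus[OF bounded_linear_ident]] sd) auto
  have M: "smooth_on UNIV ?M"
    by (intro smooth_on_compose[OF ss] smooth_on_add smooth_on_const sd) auto
  show "smooth_on UNIV \<beta>"
    unfolding \<beta>_def
    by (intro smooth_on_mult smooth_on_inverse smooth_on_add N M) (use pos in \<open>auto simp: less_imp_neq[symmetric]\<close>)
  show "\<beta> x = 1" if "x \<in> ball a (R / 2)" for x
  proof -
    have "d x \<le> (R / 2)\<^sup>2" using that unfolding d by (intro power_mono) auto
    then have "?M x = 0" by (intro s) auto
    then show ?thesis using pos[of x] by (simp add: \<beta>_def)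
  qed
  show "\<beta> x = 0" if "x \<notin> ball a R" for x
  proof -
    have "d x \<ge> R\<^sup>2" using that assms unfolding d by (intro power_mono) auto
    then have "?N x = 0" by (intro s) auto
    then show ?thesis by (simp add: \<beta>_def)
  qed
qed

section \<open>Tangent vectors in coordinates\<close>

lemma smooth_funI:
  assumes "\<And>U c. (U, c) \<in> charts M \<Longrightarrow> smooth_on (c ` U) (h \<circ> inv_into U c)"
  shows "smooth_fun M h"
  using assms by (simp add: smooth_fun_def split_beta)

lemma smooth_funD:
  assumes "(U, c) \<in> charts M" "smooth_fun M h"
  shows "smooth_on (c ` U) (h \<circ> inv_into U c)"
  using bspec[OF assms(2)[unfolded smooth_fun_def] assms(1)] by simp

text \<open>Carries a function given in coordinates to one defined on the whole type. The region
  \<open>S\<close> may be smaller than the chart image, so \<open>k\<close> has to be controlled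
  only there.\<close>

definition extend_by_zero :: "'a set \<Rightarrow> ('a \<Rightarrow> 'b) \<Rightarrow> 'b set \<Rightarrow> ('b \<Rightarrow> real) \<Rightarrow> 'a \<Rightarrow> real" where
  "extend_by_zero U c S k = (\<lambda>x. if x \<in> U \<and> c x \<in> S then k (c x) else 0)"

text \<open>A smooth manifold without second countability, which is never needed and so need not be
  established for products.\<close>

locale hausdorff_atlas =
  fixes M :: "('a, 'e::euclidean_space) mfd"
  assumes hausdorff: "Hausdorff_space (mtop M)"
    and chart: "(U, c) \<in> charts M \<Longrightarrow> openin (mtop M) U \<and> open (c ` U) \<and>
        homeomorphic_map (subtopology (mtop M) U) (top_of_set (c ` U)) c"
    and cover: "(\<Union>(U, c)\<in>charts M. U) = points M"
    and compatible: "(U, c) \<in> charts M \<Longrightarrow> (V, d) \<in> charts M \<Longrightarrow>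
        smooth_on (c ` (U \<inter> V)) (d \<circ> inv_into U c)"

lemma smooth_manifold_imp_hausdorff_atlas: "smooth_manifold M \<Longrightarrow> hausdorff_atlas M"
  unfolding smooth_manifold_def hausdorff_atlas_def by fast

context hausdorff_atlas
begin

lemma chart_at:
  assumes "p \<in> points M"
  obtains U c where "(U, c) \<in> charts M" "p \<in> U"
  using assms cover by blast

lemma chart_openin: "(U, c) \<in> charts M \<Longrightarrow> openin (mtop M) U"
  and chart_open_image: "(U, c) \<in> charts M \<Longrightarrow> open (c ` U)"
  using chart by blast+

lemma chart_subset: "(U, c) \<in> charts M \<Longrightarrow> U \<subseteq> points M"
  using chart_openin openin_subset by blast

lemma chart_inj: "(U, c) \<in> charts M \<Longrightarrow> inj_on c U"
  using chart[of U c] chart_subset[of U c]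
  by (auto simp: homeomorphic_eq_everything_map Int_absorb1)

lemma chart_preimage_openin:
  assumes "(U, c) \<in> charts M" "open S"
  shows "openin (mtop M) {x \<in> U. c x \<in> S}"
proof -
  have "continuous_map (subtopology (mtop M) U) (top_of_set (c ` U)) c"
    using chart[OF assms(1)] homeomorphic_imp_continuous_map by blast
  moreover have "openin (top_of_set (c ` U)) (c ` U \<inter> S)"
    using assms(2) by (rule openin_open_Int)
  ultimately have "openin (subtopology (mtop M) U) {x \<in> topspace (subtopology (mtop M) U). c x \<in> c ` U \<inter> S}"
    by (rule openin_continuous_map_preimage)
  moreover have "{x \<in> topspace (subtopology (mtop M) U). c x \<in> c ` U \<inter> S} = {x \<in> U. c x \<in> S}"
    using chart_subset[OF assms(1)] by auto
  ultimately show ?thesis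
    using chart_openin[OF assms(1)] openin_trans_full by force
qed

lemma chart_image_open:
  assumes "(U, c) \<in> charts M" "openin (mtop M) V" "V \<subseteq> U"
  shows "open (c ` V)"
proof -
  have "open_map (subtopology (mtop M) U) (top_of_set (c ` U)) c"
    using chart[OF assms(1)] homeomorphic_imp_open_map by blast
  moreover have "openin (subtopology (mtop M) U) V"
    using assms by (simp add: openin_open_subtopology[OF chart_openin[OF assms(1)]])
  ultimately have "openin (top_of_set (c ` U)) (c ` V)"
    unfolding open_map_def by blast
  then show ?thesis
    by (simp add: openin_open_eq[OF chart_open_image[OF assms(1)]])
qed

lemma chart_inv: "(U, c) \<in> charts M \<Longrightarrow> x \<in> U \<Longrightarrow> inv_into U c (c x) = x"
  by (rule inv_into_f_f[OF chart_inj])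

lemma smooth_fun_cong:
  assumes "\<And>x. x \<in> points M \<Longrightarrow> h x = k x" "smooth_fun M h"
  shows "smooth_fun M k"
proof (rule smooth_funI)
  fix U c assume c: "(U, c) \<in> charts M"
  show "smooth_on (c ` U) (k \<circ> inv_into U c)"
  proof (rule smooth_on_cong[OF chart_open_image[OF c] _ smooth_funD[OF c assms(2)]])
    fix y assume "y \<in> c ` U"
    then have "inv_into U c y \<in> points M" by (rule subsetD[OF chart_subset[OF c] inv_into_into])
    then show "(h \<circ> inv_into U c) y = (k \<circ> inv_into U c) y" by (simp add: assms(1))
  qed
qed

lemma smooth_fun_const: "smooth_fun M (\<lambda>x. a)"
  by (rule smooth_funI) (simp add: o_def smooth_on_const)

lemma smooth_fun_add:
  assumes "smooth_fun M h" "smooth_fun M k"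
  shows "smooth_fun M (\<lambda>x. h x + k x)"
  by (rule smooth_funI)
    (use smooth_on_add[OF chart_open_image smooth_funD smooth_funD] assms in \<open>simp add: o_def\<close>)

lemma smooth_fun_mult:
  assumes "smooth_fun M h" "smooth_fun M k"
  shows "smooth_fun M (\<lambda>x. h x * k x)"
  by (rule smooth_funI)
    (use smooth_on_mult[OF chart_open_image smooth_funD smooth_funD] assms in \<open>simp add: o_def\<close>)

lemma smooth_fun_diff: "smooth_fun M h \<Longrightarrow> smooth_fun M k \<Longrightarrow> smooth_fun M (\<lambda>x. h x - k x)"
  using smooth_fun_add[OF _ smooth_fun_mult[OF smooth_fun_const[of "-1"]], of h k] by simp

lemma smooth_fun_sum:
  assumes "\<And>i. i \<in> I \<Longrightarrow> smooth_fun M (h i)"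
  shows "smooth_fun M (\<lambda>x. \<Sum>i\<in>I. h i x)"
  using assms by (induction I rule: infinite_finite_induct) (auto intro: smooth_fun_const smooth_fun_add)

text \<open>One chart around each point suffices: composing with a smooth transition map transfers
  the local statement to every other chart.\<close>

lemma smooth_funI_local:
  assumes "\<And>p. p \<in> points M \<Longrightarrow> \<exists>U c N. (U, c) \<in> charts M \<and> openin (mtop M) N \<and> p \<in> N \<and> N \<subseteq> U \<and>
      smooth_on (c ` N) (h \<circ> inv_into U c)"
  shows "smooth_fun M h"
proof (rule smooth_funI)
  fix V d assume d: "(V, d) \<in> charts M"
  show "smooth_on (d ` V) (h \<circ> inv_into V d)"
  proof (rule smooth_on_local)
    fix y assume "y \<in> d ` V"
    then obtain p where p: "p \<in> V" "y = d p" by blast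
    then obtain U c N where c: "(U, c) \<in> charts M" and N: "openin (mtop M) N" "p \<in> N" "N \<subseteq> U"
      and sm: "smooth_on (c ` N) (h \<circ> inv_into U c)"
      using assms chart_subset[OF d] by blast
    let ?T = "d ` (N \<inter> V)"
    have oT: "open ?T" by (rule chart_image_open[OF d]) (use N chart_openin[OF d] in auto)
    have oN: "open (c ` N)" by (rule chart_image_open[OF c]) (use N in auto)
    have "smooth_on ?T (c \<circ> inv_into V d)"
      using compatible[OF d c] by (rule smooth_on_subset) (use N in auto)
    then have "smooth_on ?T (\<lambda>y. (h \<circ> inv_into U c) ((c \<circ> inv_into V d) y))"
      by (rule smooth_on_compose[OF sm oT oN]) (use chart_inv[OF d] in auto)
    then have "smooth_on ?T (h \<circ> inv_into V d)"
      by (rule smooth_on_cong[OF oT, rotated]) (use chart_inv[OF d] chart_inv[OF c] N in auto)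
    then show "\<exists>T. open T \<and> y \<in> T \<and> smooth_on T (h \<circ> inv_into V d)"
      using oT p N by blast
  qed
qed

section \<open>Globalising functions given in a chart\<close>

text \<open>Inside the region the coordinate expression is \<open>k\<close> itself. At any other
  point the preimage of the closed ball is avoided; it is compact, hence closed by the Hausdorff
  property, so the function vanishes on a whole neighbourhood.\<close>

lemma smooth_fun_extend_by_zero:
  assumes c: "(U, c) \<in> charts M" and S: "open S" "cball a R \<subseteq> S" "S \<subseteq> c ` U"
    and k: "smooth_on S k" "\<And>y. y \<notin> cball a R \<Longrightarrow> k y = 0"
  shows "smooth_fun M (extend_by_zero U c S k)"
proof (rule smooth_funI_local)
  fix p assume p: "p \<in> points M"
  let ?h = "extend_by_zero U c S k" and ?K = "{x \<in> U. c x \<in> cball a R}"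
  show "\<exists>U c N. (U, c) \<in> charts M \<and> openin (mtop M) N \<and> p \<in> N \<and> N \<subseteq> U \<and>
      smooth_on (c ` N) (?h \<circ> inv_into U c)"
  proof (cases "p \<in> U \<and> c p \<in> S")
    case True
    let ?N = "{x \<in> U. c x \<in> S}"
    have im: "c ` ?N = S" using S by auto
    have "smooth_on S (?h \<circ> inv_into U c)"
    proof (rule smooth_on_cong[OF S(1) _ k(1)])
      fix y assume y: "y \<in> S"
      then obtain x where "x \<in> U" "y = c x" using S by auto
      then show "k y = (?h \<circ> inv_into U c) y"
        using y chart_inv[OF c] by (simp add: extend_by_zero_def)
    qed
    then show ?thesis
      using True c chart_preimage_openin[OF c S(1)] im
      by (intro exI[of _ U] exI[of _ c] exI[of _ ?N]) auto
  next
    case False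
    obtain V d where d: "(V, d) \<in> charts M" "p \<in> V" using chart_at[OF p] .
    have "c ` ?K = cball a R" using S by auto
    moreover have "compactin (top_of_set (c ` U)) (cball a R)"
      using S by (auto simp: compactin_subtopology)
    ultimately have "compactin (subtopology (mtop M) U) ?K"
      using homeomorphic_map_compactness_eq[OF conjunct2[OF conjunct2[OF chart[OF c]]], of ?K]
        chart_subset[OF c] by auto
    then have "compactin (mtop M) ?K" by (simp add: compactin_subtopology)
    then have cl: "closedin (mtop M) ?K" using hausdorff compactin_imp_closedin by blast
    let ?N = "V - ?K"
    have oN: "openin (mtop M) ?N" using cl chart_openin[OF d(1)] by (rule openin_diff[rotated])
    have z: "?h x = 0" if "x \<in> ?N" for x
      using that k(2) by (auto simp: extend_by_zero_def)
    have oT: "open (d ` ?N)" by (rule chart_image_open[OF d(1) oN]) auto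
    have eq: "0 = (?h \<circ> inv_into V d) y" if y: "y \<in> d ` ?N" for y
    proof -
      obtain x where "x \<in> ?N" "y = d x" using y by blast
      then show ?thesis using z[of x] chart_inv[OF d(1), of x] by simp
    qed
    have "smooth_on (d ` ?N) (?h \<circ> inv_into V d)"
      by (rule smooth_on_cong[OF oT eq smooth_on_const])
    then show ?thesis
      using False d oN S by (intro exI[of _ V] exI[of _ d] exI[of _ ?N]) auto
  qed
qed

text \<open>Turns any function smooth on \<open>S\<close> into a global smooth function with the
  same values on \<open>N\<close>, where the bump is 1. Convexity of \<open>S\<close> is there for
  Hadamard's lemma, and the bound by \<open>V\<close> lets the support be confined to a prescribed
  neighbourhood.\<close>

lemma cutoff_exists:
  assumes c: "(U, c) \<in> charts M" and p: "p \<in> U" and V: "openin (mtop M) V" "p \<in> V"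
  obtains S N \<beta> where "open S" "convex S" "c p \<in> S" "S \<subseteq> c ` (U \<inter> V)"
    "openin (mtop M) N" "p \<in> N" "N \<subseteq> U \<inter> V" "c ` N \<subseteq> S" "smooth_on UNIV \<beta>" "\<And>x. x \<in> N \<Longrightarrow> \<beta> (c x) = 1"
    "\<And>k. smooth_on S k \<Longrightarrow> smooth_fun M (extend_by_zero U c S (\<lambda>y. \<beta> y * k y))"
proof -
  have "open (c ` (U \<inter> V))"
    by (rule chart_image_open[OF c]) (use V chart_openin[OF c] in auto)
  moreover have "c p \<in> c ` (U \<inter> V)" using p V by blast
  ultimately obtain e where e: "e > 0" "ball (c p) e \<subseteq> c ` (U \<inter> V)"
    by (rule openE)
  \<comment> \<open>With half the radius, the closed ball outside which the bump vanishes still lies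
    in the open ball chosen as \<open>S\<close>.\<close>
  define R where "R = e / 2"
  have R: "R > 0" "R < e" using e by (auto simp: R_def)
  obtain \<beta> :: "'e \<Rightarrow> real" where \<beta>: "smooth_on UNIV \<beta>" "\<And>x. x \<in> ball (c p) (R / 2) \<Longrightarrow> \<beta> x = 1"
    "\<And>x. x \<notin> ball (c p) R \<Longrightarrow> \<beta> x = 0"
    by (rule bump_exists[OF R(1), of "c p"]) (rule that; assumption)
  let ?S = "ball (c p) e" and ?N = "{x \<in> U. c x \<in> ball (c p) (R / 2)}"
  have N: "?N \<subseteq> U \<inter> V"
  proof
    fix x assume x: "x \<in> ?N"
    then have "c x \<in> c ` (U \<inter> V)" using e R by auto
    then show "x \<in> U \<inter> V" using x chart_inj[OF c] by (auto dest: inj_onD)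
  qed
  show thesis
  proof (rule that[of ?S ?N \<beta>])
    show "smooth_fun M (extend_by_zero U c ?S (\<lambda>y. \<beta> y * k y))" if "smooth_on ?S k" for k
      by (rule smooth_fun_extend_by_zero[OF c, of _ "c p" R])
        (use R e that \<beta> in \<open>auto intro!: smooth_on_mult smooth_on_subset[OF \<beta>(1)]\<close>)
    show "openin (mtop M) ?N" by (rule chart_preimage_openin[OF c]) auto
  qed (use N e R p \<beta> in auto)
qed

text \<open>Chart coordinates are not arguments of a derivation, which expects global smooth
  functions; these cut-off versions are, and locality makes them equally good near
  \<open>p\<close>.\<close>

lemma coordinates_exist:
  assumes c: "(U, c) \<in> charts M" and p: "p \<in> U"
  obtains \<xi> N where "\<And>b. smooth_fun M (\<xi> b)" "openin (mtop M) N" "p \<in> N" "N \<subseteq> U"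
    "\<And>b x. x \<in> N \<Longrightarrow> \<xi> b x = c x \<bullet> b"
proof -
  obtain S N \<beta> where *: "open S" "convex S" "c p \<in> S" "S \<subseteq> c ` (U \<inter> U)"
    "openin (mtop M) N" "p \<in> N" "N \<subseteq> U \<inter> U" "c ` N \<subseteq> S" "smooth_on UNIV \<beta>"
    "\<And>x. x \<in> N \<Longrightarrow> \<beta> (c x) = 1"
    and sm: "\<And>k. smooth_on S k \<Longrightarrow> smooth_fun M (extend_by_zero U c S (\<lambda>y. \<beta> y * k y))"
    by (rule cutoff_exists[OF c p chart_openin[OF c] p]) (rule that; assumption)
  have "smooth_fun M (extend_by_zero U c S (\<lambda>y. \<beta> y * (y \<bullet> b)))" for b
    by (intro sm smooth_on_inner smooth_on_ident smooth_on_const *(1))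
  then show thesis
    by (rule that[of "\<lambda>b. extend_by_zero U c S (\<lambda>y. \<beta> y * (y \<bullet> b))" N])
      (use * in \<open>auto simp: extend_by_zero_def\<close>)
qed

section \<open>Derivations at a point: algebra, locality, coordinate expression\<close>

context
  fixes p v
  assumes v: "v \<in> tangent_space M p"
begin

lemma tv_nonsmooth: "\<not> smooth_fun M h \<Longrightarrow> v h = 0"
  using v by (simp add: tangent_space_def)

lemma tv_lincomb:
  "smooth_fun M h \<Longrightarrow> smooth_fun M k \<Longrightarrow> v (\<lambda>x. a * h x + b * k x) = a * v h + b * v k"
  using v by (simp add: tangent_space_def)

lemma tv_mult:
  "smooth_fun M h \<Longrightarrow> smooth_fun M k \<Longrightarrow> v (\<lambda>x. h x * k x) = h p * v k + k p * v h"
  using v by (simp add: tangent_space_def)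

lemma tv_add: "smooth_fun M h \<Longrightarrow> smooth_fun M k \<Longrightarrow> v (\<lambda>x. h x + k x) = v h + v k"
  using tv_lincomb[of h k 1 1] by simp

lemma tv_diff: "smooth_fun M h \<Longrightarrow> smooth_fun M k \<Longrightarrow> v (\<lambda>x. h x - k x) = v h - v k"
  using tv_lincomb[of h k 1 "-1"] by simp

text \<open>The Leibniz rule on 1 = 1 * 1 gives v(1) = 2 v(1), hence v(1) = 0.\<close>

lemma tv_const: "v (\<lambda>x. a) = 0"
  using tv_mult[OF smooth_fun_const smooth_fun_const, of 1 1]
    tv_lincomb[OF smooth_fun_const smooth_fun_const, of a 1 0 1] by simp

lemma tv_cmult: "smooth_fun M h \<Longrightarrow> v (\<lambda>x. a * h x) = a * v h"
  using tv_mult[OF smooth_fun_const, of h a] tv_const by simp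

lemma tv_sum: "(\<And>i. i \<in> I \<Longrightarrow> smooth_fun M (h i)) \<Longrightarrow> v (\<lambda>x. \<Sum>i\<in>I. h i x) = (\<Sum>i\<in>I. v (h i))"
  by (induction I rule: infinite_finite_induct) (auto simp: tv_const tv_add smooth_fun_sum)

text \<open>Multiply the difference \<open>u\<close> of the two functions by a cut-off supported in
  \<open>N\<close> with value 1 at \<open>p\<close>. The product is identically 0, and as
  \<open>u\<close> vanishes at \<open>p\<close> the Leibniz rule leaves just
  \<open>v u\<close>.\<close>

lemma tv_cong_local:
  assumes "smooth_fun M h" "smooth_fun M k" "openin (mtop M) N" "p \<in> N" "\<And>x. x \<in> N \<Longrightarrow> h x = k x"
  shows "v h = v k"
proof -
  have "p \<in> points M" using assms openin_subset by blast
  then obtain U c where c: "(U, c) \<in> charts M" "p \<in> U" by (rule chart_at)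
  obtain S N' \<beta> where *: "open S" "convex S" "c p \<in> S" "S \<subseteq> c ` (U \<inter> N)"
    "openin (mtop M) N'" "p \<in> N'" "N' \<subseteq> U \<inter> N" "c ` N' \<subseteq> S" "smooth_on UNIV \<beta>"
    "\<And>x. x \<in> N' \<Longrightarrow> \<beta> (c x) = 1"
    and sm: "\<And>k. smooth_on S k \<Longrightarrow> smooth_fun M (extend_by_zero U c S (\<lambda>y. \<beta> y * k y))"
    by (rule cutoff_exists[OF c assms(3,4)]) (rule that; assumption)
  let ?\<chi> = "extend_by_zero U c S (\<lambda>y. \<beta> y * 1)" and ?u = "\<lambda>x. h x - k x"
  have "?\<chi> x * ?u x = 0" for x
  proof (cases "x \<in> U \<and> c x \<in> S")
    case True
    then have "x \<in> N" using * inj_onD[OF chart_inj[OF c(1)]] by blast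
    then show ?thesis using assms(5) by simp
  qed (auto simp: extend_by_zero_def)
  then have "v (\<lambda>x. ?\<chi> x * ?u x) = 0" using tv_const[of 0] by presburger
  then have "?\<chi> p * v ?u = 0"
    using tv_mult[OF sm[OF smooth_on_const[of S 1]] smooth_fun_diff[OF assms(1,2)]] assms by simp
  then have "v ?u = 0" using * c by (simp add: extend_by_zero_def)
  then show ?thesis using tv_diff assms by simp
qed

text \<open>The values of a function outside the carrier do not matter to a tangent vector, even
  though it is a functional on all functions of the type: locality with the whole space as
  neighbourhood.\<close>

lemma tv_cong:
  assumes "smooth_fun M h" "p \<in> points M" "\<And>x. x \<in> points M \<Longrightarrow> h x = k x"
  shows "v h = v k"
  using tv_cong_local[OF assms(1) smooth_fun_cong[OF assms(3,1)] openin_topspace assms(2,3)] .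

text \<open>Near \<open>p\<close>, Hadamard's lemma writes \<open>h\<close> as a constant plus a sum
  of products of coordinate differences and smooth functions; the Leibniz rule keeps only
  v(coordinate) times the partial derivative. The coordinate functions and \<open>N\<close> are
  parameters, so that one choice serves at all points of \<open>N\<close> and product coordinates
  can be inserted later.\<close>

lemma coordinate_expansion:
  assumes c: "(U, c) \<in> charts M" and h: "smooth_fun M h"
    and \<xi>: "\<And>b. b \<in> Basis \<Longrightarrow> smooth_fun M (\<xi> b)" "\<And>b x. b \<in> Basis \<Longrightarrow> x \<in> N \<Longrightarrow> \<xi> b x = c x \<bullet> b"
    and N: "openin (mtop M) N" "p \<in> N" "N \<subseteq> U"
  shows "v h = frechet_derivative (h \<circ> inv_into U c) (at (c p)) (\<Sum>b\<in>Basis. v (\<xi> b) *\<^sub>R b)"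
proof -
  let ?H = "h \<circ> inv_into U c"
  have p: "p \<in> U" using N by auto
  obtain S N' \<beta> where S: "open S" "convex S" "c p \<in> S" "S \<subseteq> c ` (U \<inter> N)"
    and N': "openin (mtop M) N'" "p \<in> N'" "N' \<subseteq> U \<inter> N" "c ` N' \<subseteq> S" "smooth_on UNIV \<beta>"
      "\<And>x. x \<in> N' \<Longrightarrow> \<beta> (c x) = 1"
    and sm: "\<And>k. smooth_on S k \<Longrightarrow> smooth_fun M (extend_by_zero U c S (\<lambda>y. \<beta> y * k y))"
    by (rule cutoff_exists[OF c p N(1,2)]) (rule that; assumption)
  have H: "smooth_on S ?H"
    using smooth_on_subset[OF smooth_funD[OF c h]] S by blast
  obtain G where G: "\<And>b. smooth_on S (G b)" "\<And>b. G b (c p) = frechet_derivative ?H (at (c p)) b"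
    "\<And>x. x \<in> S \<Longrightarrow> ?H x = ?H (c p) + (\<Sum>b\<in>Basis. ((x - c p) \<bullet> b) * G b x)"
    by (rule hadamard[OF S(1-3) H]) (rule that; assumption)
  let ?g = "\<lambda>b. extend_by_zero U c S (\<lambda>y. \<beta> y * G b y)"
  \<comment> \<open>Shifted so as to vanish at \<open>p\<close>: this removes the Leibniz term in
    which \<open>v\<close> would act on the cut-off Hadamard quotient.\<close>
  let ?u = "\<lambda>b x. \<xi> b x - c p \<bullet> b"
  have g: "smooth_fun M (?g b)" for b using sm G by blast
  have g_val: "?g b x = G b (c x)" if "x \<in> N'" for b x
    using that N' by (auto simp: extend_by_zero_def)
  have u: "smooth_fun M (?u b)" if "b \<in> Basis" for b using \<xi> that smooth_fun_diff smooth_fun_const by blast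
  have su: "smooth_fun M (\<lambda>x. ?u b x * ?g b x)" if "b \<in> Basis" for b
    using smooth_fun_mult[OF u[OF that] g] .
  have "v h = v (\<lambda>x. h p + (\<Sum>b\<in>Basis. ?u b x * ?g b x))"
  proof (rule tv_cong_local[OF h _ N'(1,2)])
    show "smooth_fun M (\<lambda>x. h p + (\<Sum>b\<in>Basis. ?u b x * ?g b x))"
      by (rule smooth_fun_add[OF smooth_fun_const smooth_fun_sum[OF su]])
    fix x assume x: "x \<in> N'"
    then have "?H (c x) = ?H (c p) + (\<Sum>b\<in>Basis. ((c x - c p) \<bullet> b) * G b (c x))"
      using N' by (intro G(3)) auto
    moreover have "?H (c x) = h x" "?H (c p) = h p" using x N' p chart_inv[OF c] by auto
    moreover have "(\<Sum>b\<in>Basis. ((c x - c p) \<bullet> b) * G b (c x)) = (\<Sum>b\<in>Basis. ?u b x * ?g b x)"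
      using x N' \<xi>(2) g_val by (intro sum.cong) (auto simp: inner_diff_left)
    ultimately show "h x = h p + (\<Sum>b\<in>Basis. ?u b x * ?g b x)" by simp
  qed
  also have "\<dots> = (\<Sum>b\<in>Basis. v (\<lambda>x. ?u b x * ?g b x))"
    by (simp add: tv_add[OF smooth_fun_const smooth_fun_sum[OF su]] tv_const tv_sum[OF su])
  also have "\<dots> = (\<Sum>b\<in>Basis. v (\<xi> b) * frechet_derivative ?H (at (c p)) b)"
  proof (rule sum.cong)
    fix b :: 'e assume b: "b \<in> Basis"
    have "v (?u b) = v (\<xi> b)" using tv_diff[OF \<xi>(1)[OF b] smooth_fun_const] tv_const by simp
    then show "v (\<lambda>x. ?u b x * ?g b x) = v (\<xi> b) * frechet_derivative ?H (at (c p)) b"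
      using tv_mult[OF u[OF b] g] \<xi>(2)[OF b N(2)] g_val[OF N'(2)] G(2) by simp
  qed simp
  also have "\<dots> = frechet_derivative ?H (at (c p)) (\<Sum>b\<in>Basis. v (\<xi> b) *\<^sub>R b)"
    using has_derivative_linear[OF smooth_on_has_derivative[OF H S(3)]]
    by (simp add: linear_sum linear_scale)
  finally show ?thesis .
qed

end

text \<open>A directional derivative in a chart, with value 0 on non-smooth functions as the
  encoding demands. The scalar \<open>r\<close> makes room for the bump factor in
  \<open>vector_field_through\<close>.\<close>

lemma chart_derivation:
  assumes c: "(U, c) \<in> charts M" and x: "x \<in> U"
  shows "(\<lambda>h. if smooth_fun M h then r * frechet_derivative (h \<circ> inv_into U c) (at (c x)) w else 0)
    \<in> tangent_space M x" (is "?v \<in> _")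
proof -
  let ?D = "\<lambda>h. frechet_derivative (h \<circ> inv_into U c) (at (c x))"
  have D: "((h \<circ> inv_into U c) has_derivative ?D h) (at (c x))" if "smooth_fun M h" for h
    using smooth_on_has_derivative[OF smooth_funD[OF c that]] x by blast
  have "?v (\<lambda>x. a * h x + b * k x) = a * ?v h + b * ?v k"
    if h: "smooth_fun M h" and k: "smooth_fun M k" for h k a b
  proof -
    have "((\<lambda>y. a * (h \<circ> inv_into U c) y + b * (k \<circ> inv_into U c) y) has_derivative
      (\<lambda>w. a * ?D h w + b * ?D k w)) (at (c x))"
      by (intro has_derivative_add has_derivative_mult_right D h k)
    from frechet_derivative_at[OF this]
    have "?D (\<lambda>x. a * h x + b * k x) w = a * ?D h w + b * ?D k w"
      by (simp add: o_def fun_eq_iff)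
    moreover have "smooth_fun M (\<lambda>x. a * h x + b * k x)"
      by (intro smooth_fun_add smooth_fun_mult smooth_fun_const h k)
    ultimately show ?thesis using h k by (simp add: algebra_simps)
  qed
  moreover have "?v (\<lambda>x. h x * k x) = h x * ?v k + k x * ?v h"
    if h: "smooth_fun M h" and k: "smooth_fun M k" for h k
  proof -
    have "((\<lambda>y. (h \<circ> inv_into U c) y * (k \<circ> inv_into U c) y) has_derivative
      (\<lambda>w. (h \<circ> inv_into U c) (c x) * ?D k w + ?D h w * (k \<circ> inv_into U c) (c x))) (at (c x))"
      by (intro has_derivative_mult D h k)
    from frechet_derivative_at[OF this]
    have "?D (\<lambda>x. h x * k x) w = h x * ?D k w + ?D h w * k x"
      using chart_inv[OF c x] by (simp add: o_def fun_eq_iff)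
    moreover have "smooth_fun M (\<lambda>x. h x * k x)"
      by (intro smooth_fun_mult h k)
    ultimately show ?thesis using h k by (simp add: algebra_simps)
  qed
  ultimately show ?thesis unfolding tangent_space_def by simp
qed

lemma tangent_space_zero: "(\<lambda>h. 0) \<in> tangent_space M p"
  by (simp add: tangent_space_def)

text \<open>The field has constant coefficients in a chart, damped by a bump that is 1 at
  \<open>p\<close>; \<open>coordinate_expansion\<close> identifies its value there with
  \<open>v\<close>. The structure axioms are stated for fields, and this makes them available for a
  single tangent vector.\<close>

lemma vector_field_through:
  assumes p: "p \<in> points M" and v: "v \<in> tangent_space M p"
  obtains X where "X \<in> vector_fields M" "X p = v"
proof -
  obtain U c where c: "(U, c) \<in> charts M" "p \<in> U" using chart_at[OF p] .
  obtain \<xi> N where \<xi>s: "\<And>b. smooth_fun M (\<xi> b)" and N: "openin (mtop M) N" "p \<in> N" "N \<subseteq> U"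
    and \<xi>N: "\<And>b x. x \<in> N \<Longrightarrow> \<xi> b x = c x \<bullet> b"
    by (rule coordinates_exist[OF c]) (rule that; assumption)
  define w where "w = (\<Sum>b\<in>Basis. v (\<xi> b) *\<^sub>R b)"
  obtain S N' \<beta> where S: "open S" "convex S" "c p \<in> S" "S \<subseteq> c ` (U \<inter> U)"
    and N': "openin (mtop M) N'" "p \<in> N'" "N' \<subseteq> U \<inter> U" "c ` N' \<subseteq> S" "smooth_on UNIV \<beta>"
      "\<And>x. x \<in> N' \<Longrightarrow> \<beta> (c x) = 1"
    and sm: "\<And>k. smooth_on S k \<Longrightarrow> smooth_fun M (extend_by_zero U c S (\<lambda>y. \<beta> y * k y))"
    by (rule cutoff_exists[OF c chart_openin[OF c(1)] c(2)]) (rule that; assumption)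
  define X where "X x = (if x \<in> U \<and> c x \<in> S then
      (\<lambda>h. if smooth_fun M h then \<beta> (c x) * frechet_derivative (h \<circ> inv_into U c) (at (c x)) w else 0)
      else (\<lambda>h. 0))" for x
  have "X x \<in> tangent_space M x" for x
    unfolding X_def using chart_derivation[OF c(1)] tangent_space_zero by auto
  moreover have "smooth_fun M (\<lambda>x. X x h)" if h: "smooth_fun M h" for h
  proof -
    have "smooth_on S (\<lambda>y. frechet_derivative (h \<circ> inv_into U c) (at y) w)"
      using smooth_on_frechet_derivative[OF smooth_on_subset[OF smooth_funD[OF c(1) h]]] S by blast
    from sm[OF this] show ?thesis
      by (rule smooth_fun_cong[rotated]) (use h in \<open>auto simp: X_def extend_by_zero_def\<close>)
  qed
  ultimately have "X \<in> vector_fields M" by (simp add: vector_fields_def)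
  moreover have "X p = v"
  proof
    fix h
    show "X p h = v h"
      using coordinate_expansion[OF v c(1) _ \<xi>s \<xi>N N, of h] tv_nonsmooth[OF v, of h] c S N'
      by (auto simp: X_def w_def)
  qed
  ultimately show thesis using that by blast
qed

lemma tangent_space_lincomb:
  assumes "v \<in> tangent_space M p" "w \<in> tangent_space M p"
  shows "(\<lambda>h. a * v h + b * w h) \<in> tangent_space M p"
  using assms by (simp add: tangent_space_def algebra_simps)

lemma vector_field_tangent: "X \<in> vector_fields M \<Longrightarrow> p \<in> points M \<Longrightarrow> X p \<in> tangent_space M p"
  by (simp add: vector_fields_def)

lemma vector_field_smooth: "X \<in> vector_fields M \<Longrightarrow> smooth_fun M h \<Longrightarrow> smooth_fun M (\<lambda>p. X p h)"
  by (simp add: vector_fields_def)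

lemma zero_field: "zero_field \<in> vector_fields M"
  by (simp add: vector_fields_def zero_field_def tangent_space_zero smooth_fun_const)

end

section \<open>Products of manifolds\<close>

lemma map_prod_image_Times: "map_prod f g ` (A \<times> B) = f ` A \<times> g ` B"
  by force

lemma inv_into_map_prod:
  assumes "inj_on f A" "inj_on g B" "y \<in> f ` A" "w \<in> g ` B"
  shows "inv_into (A \<times> B) (map_prod f g) (y, w) = (inv_into A f y, inv_into B g w)"
proof (rule inv_into_f_eq)
  show "inj_on (map_prod f g) (A \<times> B)" using assms map_prod_inj_on by blast
qed (use assms in \<open>auto simp: f_inv_into_f inv_into_into\<close>)

lemma homeomorphic_map_map_prod:
  assumes "homeomorphic_map X X' f" "homeomorphic_map Y Y' g"
  shows "homeomorphic_map (prod_topology X Y) (prod_topology X' Y') (map_prod f g)"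
proof -
  obtain f' g' where "homeomorphic_maps X X' f f'" "homeomorphic_maps Y Y' g g'"
    using assms unfolding homeomorphic_map_maps by blast
  then have "homeomorphic_maps (prod_topology X Y) (prod_topology X' Y')
      (\<lambda>(x, y). (f x, g y)) (\<lambda>(x, y). (f' x, g' y))"
    unfolding homeomorphic_maps_prod by blast
  then show ?thesis
    unfolding homeomorphic_map_maps map_prod_def by blast
qed

lemma points_prod_mfd [simp]: "points (prod_mfd M1 M2) = points M1 \<times> points M2"
  by (simp add: prod_mfd_def)

locale two_atlases = M1: hausdorff_atlas M1 + M2: hausdorff_atlas M2
  for M1 :: "('a, 'e::euclidean_space) mfd" and M2 :: "('b, 'f::euclidean_space) mfd"
begin

abbreviation P :: "('a \<times> 'b, 'e \<times> 'f) mfd" where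
  "P \<equiv> prod_mfd M1 M2"

lemma prod_chart: "(U, c) \<in> charts M1 \<Longrightarrow> (V, d) \<in> charts M2 \<Longrightarrow> (U \<times> V, map_prod c d) \<in> charts P"
  by (auto simp: prod_mfd_def)

lemma prod_chartE:
  assumes "(W, e) \<in> charts P"
  obtains U c V d where "W = U \<times> V" "e = map_prod c d" "(U, c) \<in> charts M1" "(V, d) \<in> charts M2"
  using assms by (auto simp: prod_mfd_def)

lemma prod_chart_inv:
  assumes "(U, c) \<in> charts M1" "(V, d) \<in> charts M2" "y \<in> c ` U" "w \<in> d ` V"
  shows "inv_into (U \<times> V) (map_prod c d) (y, w) = (inv_into U c y, inv_into V d w)"
  using assms inv_into_map_prod M1.chart_inj M2.chart_inj by metis

lemma prod_chart_open:
  assumes "(U, c) \<in> charts M1" "(V, d) \<in> charts M2"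
  shows "open (c ` U \<times> d ` V)"
  using assms open_Times M1.chart_open_image M2.chart_open_image by metis

text \<open>Replaces the inverse of a product chart, an opaque \<open>inv_into\<close>, by the
  inverses of its components; together with the converse below it is how smoothness on the product
  is handled.\<close>

lemma smooth_fun_prodD:
  assumes "(U, c) \<in> charts M1" "(V, d) \<in> charts M2" "smooth_fun P h"
  shows "smooth_on (c ` U \<times> d ` V) (\<lambda>z. h (inv_into U c (fst z), inv_into V d (snd z)))"
proof (rule smooth_on_cong[OF prod_chart_open[OF assms(1,2)]])
  show "smooth_on (c ` U \<times> d ` V) (h \<circ> inv_into (U \<times> V) (map_prod c d))"
    using smooth_funD[OF prod_chart[OF assms(1,2)] assms(3)] unfolding map_prod_image_Times .
  fix z assume "z \<in> c ` U \<times> d ` V"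
  then show "(h \<circ> inv_into (U \<times> V) (map_prod c d)) z = h (inv_into U c (fst z), inv_into V d (snd z))"
    using prod_chart_inv[OF assms(1,2), of "fst z" "snd z"] by (simp add: mem_Times_iff)
qed

lemma smooth_fun_prodI:
  assumes "\<And>U c V d. (U, c) \<in> charts M1 \<Longrightarrow> (V, d) \<in> charts M2 \<Longrightarrow>
      smooth_on (c ` U \<times> d ` V) (\<lambda>z. h (inv_into U c (fst z), inv_into V d (snd z)))"
  shows "smooth_fun P h"
proof (rule smooth_funI)
  fix W e assume "(W, e) \<in> charts P"
  then obtain U c V d where *: "W = U \<times> V" "e = map_prod c d" "(U, c) \<in> charts M1" "(V, d) \<in> charts M2"
    by (rule prod_chartE)
  have "(\<lambda>z. h (inv_into U c (fst z), inv_into V d (snd z))) z = (h \<circ> inv_into W e) z"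
    if "z \<in> c ` U \<times> d ` V" for z
    using that prod_chart_inv[OF *(3,4), of "fst z" "snd z"] by (simp add: * mem_Times_iff)
  from smooth_on_cong[OF prod_chart_open[OF *(3,4)] this assms[OF *(3,4)]]
  show "smooth_on (e ` W) (h \<circ> inv_into W e)"
    unfolding *(1,2) map_prod_image_Times .
qed

lemma prod_hausdorff_atlas: "hausdorff_atlas P"
proof
  show "Hausdorff_space (mtop P)"
    using M1.hausdorff M2.hausdorff by (simp add: prod_mfd_def Hausdorff_space_prod_topology)
  show "openin (mtop P) W \<and> open (e ` W) \<and> homeomorphic_map (subtopology (mtop P) W) (top_of_set (e ` W)) e"
    if We: "(W, e) \<in> charts P" for W e
  proof -
    obtain U c V d where *: "W = U \<times> V" "e = map_prod c d" "(U, c) \<in> charts M1" "(V, d) \<in> charts M2"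
      using prod_chartE[OF We] by metis
    have "homeomorphic_map (prod_topology (subtopology (mtop M1) U) (subtopology (mtop M2) V))
        (prod_topology (top_of_set (c ` U)) (top_of_set (d ` V))) (map_prod c d)"
      using M1.chart[OF *(3)] M2.chart[OF *(4)] homeomorphic_map_map_prod by metis
    then show ?thesis
      using M1.chart[OF *(3)] M2.chart[OF *(4)] prod_chart_open[OF *(3,4)]
      by (simp add: * prod_mfd_def map_prod_image_Times subtopology_Times openin_prod_Times_iff)
  qed
  show "(\<Union>(W, e)\<in>charts P. W) = points P"
  proof
    show "(\<Union>(W, e)\<in>charts P. W) \<subseteq> points P"
    proof clarify
      fix x y W e assume "(W, e) \<in> charts P" and m: "(x, y) \<in> W"
      then obtain U c V d where "W = U \<times> V" "(U, c) \<in> charts M1" "(V, d) \<in> charts M2"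
        using prod_chartE by metis
      then show "(x, y) \<in> points P"
        using m M1.chart_subset[of U c] M2.chart_subset[of V d] by auto
    qed
    show "points P \<subseteq> (\<Union>(W, e)\<in>charts P. W)"
    proof
      fix z assume "z \<in> points P"
      then have "fst z \<in> points M1" "snd z \<in> points M2" by auto
      then obtain U c V d where "(U, c) \<in> charts M1" "fst z \<in> U" "(V, d) \<in> charts M2" "snd z \<in> V"
        using M1.chart_at M2.chart_at by metis
      then have "(U \<times> V, map_prod c d) \<in> charts P" "z \<in> U \<times> V"
        using prod_chart by (auto simp: mem_Times_iff)
      then show "z \<in> (\<Union>(W, e)\<in>charts P. W)" by blast
    qed
  qed
  show "smooth_on (e ` (W \<inter> W')) (e' \<circ> inv_into W e)"
    if We: "(W, e) \<in> charts P" and We': "(W', e') \<in> charts P" for W e W' e'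
  proof -
    obtain U c V d where *: "W = U \<times> V" "e = map_prod c d" "(U, c) \<in> charts M1" "(V, d) \<in> charts M2"
      using prod_chartE[OF We] by metis
    obtain U' c' V' d' where st: "W' = U' \<times> V'" "e' = map_prod c' d'"
      "(U', c') \<in> charts M1" "(V', d') \<in> charts M2"
      using prod_chartE[OF We'] by metis
    let ?A = "c ` (U \<inter> U')" and ?B = "d ` (V \<inter> V')"
    have oA: "open ?A" by (rule M1.chart_image_open[OF *(3)]) (use *(3) st(3) M1.chart_openin in auto)
    have oB: "open ?B" by (rule M2.chart_image_open[OF *(4)]) (use *(4) st(4) M2.chart_openin in auto)
    have o: "open (?A \<times> ?B)" using oA oB by (rule open_Times)
    have 1: "smooth_on (?A \<times> ?B) (\<lambda>z. (c' \<circ> inv_into U c) (fst z))"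
      by (rule smooth_on_compose[OF M1.compatible[OF *(3) st(3)] o oA smooth_on_linear[OF o bounded_linear_fst]]) auto
    have 2: "smooth_on (?A \<times> ?B) (\<lambda>z. (d' \<circ> inv_into V d) (snd z))"
      by (rule smooth_on_compose[OF M2.compatible[OF *(4) st(4)] o oB smooth_on_linear[OF o bounded_linear_snd]]) auto
    have "((c' \<circ> inv_into U c) (fst z), (d' \<circ> inv_into V d) (snd z)) = (e' \<circ> inv_into W e) z"
      if z: "z \<in> ?A \<times> ?B" for z
      using prod_chart_inv[OF *(3,4), of "fst z" "snd z"] z by (auto simp: * st)
    from smooth_on_cong[OF o this smooth_on_Pair[OF o 1 2]]
    have "smooth_on (?A \<times> ?B) (e' \<circ> inv_into W e)" .
    moreover have "e ` (W \<inter> W') = ?A \<times> ?B"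
      by (simp add: * st map_prod_image_Times Times_Int_Times)
    ultimately show ?thesis by simp
  qed
qed

sublocale P: hausdorff_atlas P
  by (rule prod_hausdorff_atlas)

lemma smooth_fun_fst:
  assumes "smooth_fun M1 h"
  shows "smooth_fun P (\<lambda>z. h (fst z))"
proof (rule smooth_fun_prodI)
  fix U c V d assume *: "(U, c) \<in> charts M1" "(V, d) \<in> charts M2"
  note o = prod_chart_open[OF *]
  have "smooth_on (c ` U \<times> d ` V) (\<lambda>z. (h \<circ> inv_into U c) (fst z))"
    by (rule smooth_on_compose[OF smooth_funD[OF *(1) assms] o M1.chart_open_image[OF *(1)]
        smooth_on_linear[OF o bounded_linear_fst]]) auto
  then show "smooth_on (c ` U \<times> d ` V) (\<lambda>z. h (fst (inv_into U c (fst z), inv_into V d (snd z))))"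
    by simp
qed

lemma smooth_fun_snd:
  assumes "smooth_fun M2 h"
  shows "smooth_fun P (\<lambda>z. h (snd z))"
proof (rule smooth_fun_prodI)
  fix U c V d assume *: "(U, c) \<in> charts M1" "(V, d) \<in> charts M2"
  note o = prod_chart_open[OF *]
  have "smooth_on (c ` U \<times> d ` V) (\<lambda>z. (h \<circ> inv_into V d) (snd z))"
    by (rule smooth_on_compose[OF smooth_funD[OF *(2) assms] o M2.chart_open_image[OF *(2)]
        smooth_on_linear[OF o bounded_linear_snd]]) auto
  then show "smooth_on (c ` U \<times> d ` V) (\<lambda>z. h (snd (inv_into U c (fst z), inv_into V d (snd z))))"
    by simp
qed

lemma smooth_fun_slice1:
  assumes H: "smooth_fun P H" and q: "q \<in> points M2"
  shows "smooth_fun M1 (\<lambda>x. H (x, q))"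
proof (rule smooth_funI)
  fix U c assume c: "(U, c) \<in> charts M1"
  obtain V d where d: "(V, d) \<in> charts M2" "q \<in> V" using M2.chart_at[OF q] .
  note o = M1.chart_open_image[OF c]
  have "smooth_on (c ` U) (\<lambda>y. (\<lambda>z. H (inv_into U c (fst z), inv_into V d (snd z))) (y, d q))"
    by (rule smooth_on_compose[OF smooth_fun_prodD[OF c d(1) H] o prod_chart_open[OF c d(1)]
        smooth_on_Pair[OF o smooth_on_ident[OF o] smooth_on_const]]) (use d in auto)
  then show "smooth_on (c ` U) ((\<lambda>x. H (x, q)) \<circ> inv_into U c)"
    using M2.chart_inv[OF d] by (simp add: o_def)
qed

text \<open>Reduces statements about the second factor to those about the first, by interpreting the
  locale with the factors exchanged.\<close>

lemma smooth_fun_swap: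
  assumes H: "smooth_fun P H"
  shows "smooth_fun (prod_mfd M2 M1) (\<lambda>z. H (snd z, fst z))"
proof -
  interpret sw: two_atlases M2 M1 by unfold_locales
  show ?thesis
  proof (rule sw.smooth_fun_prodI)
    fix V d U c assume *: "(V, d) \<in> charts M2" "(U, c) \<in> charts M1"
    note o = sw.prod_chart_open[OF *]
    have "smooth_on (d ` V \<times> c ` U)
        (\<lambda>z. (\<lambda>z. H (inv_into U c (fst z), inv_into V d (snd z))) (snd z, fst z))"
      by (rule smooth_on_compose[OF smooth_fun_prodD[OF *(2,1) H] o prod_chart_open[OF *(2,1)]
          smooth_on_Pair[OF o smooth_on_linear[OF o bounded_linear_snd]
            smooth_on_linear[OF o bounded_linear_fst]]]) auto
    then show "smooth_on (d ` V \<times> c ` U)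
        (\<lambda>z. H (snd (inv_into V d (fst z), inv_into U c (snd z)), fst (inv_into V d (fst z), inv_into U c (snd z))))"
      by simp
  qed
qed

lemma smooth_fun_slice2:
  assumes H: "smooth_fun P H" and p: "p \<in> points M1"
  shows "smooth_fun M2 (\<lambda>y. H (p, y))"
proof -
  interpret sw: two_atlases M2 M1 by unfold_locales
  show ?thesis
    using sw.smooth_fun_slice1[OF smooth_fun_swap[OF H] p] by simp
qed

text \<open>An abstract derivation applied slice by slice shows nothing of its joint dependence on
  both points. With coordinate functions that do not change with the base point,
  \<open>coordinate_expansion\<close> rewrites it locally as a sum of the smooth coefficients
  \<open>X x (\<xi> b)\<close> times the partial derivatives of \<open>H\<close> in the directions
  \<open>(b, 0)\<close>.\<close>

lemma smooth_fun_field_slice1: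
  assumes H: "smooth_fun P H" and X: "X \<in> vector_fields M1"
  shows "smooth_fun P (\<lambda>z. X (fst z) (\<lambda>x. H (x, snd z)))"
proof (rule P.smooth_funI_local)
  fix z assume z: "z \<in> points P"
  obtain p q where pq: "z = (p, q)" "p \<in> points M1" "q \<in> points M2" using z by auto
  obtain U c where c: "(U, c) \<in> charts M1" "p \<in> U" using M1.chart_at[OF pq(2)] .
  obtain V d where d: "(V, d) \<in> charts M2" "q \<in> V" using M2.chart_at[OF pq(3)] .
  obtain \<xi> N where \<xi>: "\<And>b. smooth_fun M1 (\<xi> b)" and N: "openin (mtop M1) N" "p \<in> N" "N \<subseteq> U"
    and \<xi>N: "\<And>b x. x \<in> N \<Longrightarrow> \<xi> b x = c x \<bullet> b"
    by (rule M1.coordinates_exist[OF c]) (rule that; assumption)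
  let ?F = "\<lambda>z. X (fst z) (\<lambda>x. H (x, snd z))"
  let ?S = "c ` N \<times> d ` V" and ?T = "c ` U \<times> d ` V"
  let ?HH = "\<lambda>z. H (inv_into U c (fst z), inv_into V d (snd z))"
  let ?DH = "\<lambda>z. frechet_derivative ?HH (at z)"
  have oN: "open (c ` N)" by (rule M1.chart_image_open[OF c(1) N(1,3)])
  have oS: "open ?S" by (rule open_Times[OF oN M2.chart_open_image[OF d(1)]])
  have ST: "?S \<subseteq> ?T" using N(3) by auto
  have HH: "smooth_on ?T ?HH" by (rule smooth_fun_prodD[OF c(1) d(1) H])
  have DH: "smooth_on ?S (\<lambda>z. ?DH z v)" for v
    by (rule smooth_on_frechet_derivative[OF smooth_on_subset[OF HH ST]])
  have X\<xi>: "smooth_on ?S (\<lambda>z. ((\<lambda>x. X x (\<xi> b)) \<circ> inv_into U c) (fst z))" for b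
  proof (rule smooth_on_compose[OF _ oS oN smooth_on_linear[OF oS bounded_linear_fst]])
    show "smooth_on (c ` N) ((\<lambda>x. X x (\<xi> b)) \<circ> inv_into U c)"
      using smooth_on_subset[OF smooth_funD[OF c(1) M1.vector_field_smooth[OF X \<xi>]]] N(3) by blast
  qed auto
  have sm: "smooth_on ?S (\<lambda>z. \<Sum>b\<in>Basis. ((\<lambda>x. X x (\<xi> b)) \<circ> inv_into U c) (fst z) * ?DH z (b, 0))"
    by (intro smooth_on_sum smooth_on_mult oS X\<xi> DH)
  have eq: "(\<Sum>b\<in>Basis. ((\<lambda>x. X x (\<xi> b)) \<circ> inv_into U c) (fst y) * ?DH y (b, 0)) =
      (?F \<circ> inv_into (U \<times> V) (map_prod c d)) y" if y: "y \<in> ?S" for y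
  proof -
    obtain p' q' where y': "p' \<in> N" "q' \<in> V" "y = (c p', d q')" using y by auto
    have p'U: "p' \<in> U" using y' N by auto
    have inv: "inv_into U c (c p') = p'" "inv_into V d (d q') = q'"
      using M1.chart_inv[OF c(1) p'U] M2.chart_inv[OF d(1) y'(2)] by auto
    have p'P: "p' \<in> points M1" "q' \<in> points M2"
      using p'U y' M1.chart_subset[OF c(1)] M2.chart_subset[OF d(1)] by auto
    have DHd: "(?HH has_derivative ?DH y) (at y)"
      using smooth_on_has_derivative[OF HH] y ST by blast
    have "((\<lambda>x. (x, d q')) has_derivative (\<lambda>u. (u, 0))) (at (c p'))"
      by (auto intro!: derivative_eq_intros)
    from has_derivative_compose[OF this, of ?HH "?DH y"] DHd
    have "((\<lambda>x. ?HH (x, d q')) has_derivative (\<lambda>u. ?DH y (u, 0))) (at (c p'))"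
      by (simp add: y')
    moreover have "(\<lambda>x. ?HH (x, d q')) = (\<lambda>x. H (x, q')) \<circ> inv_into U c"
      by (auto simp: inv)
    ultimately have "(((\<lambda>x. H (x, q')) \<circ> inv_into U c) has_derivative (\<lambda>u. ?DH y (u, 0))) (at (c p'))"
      by (simp only:)
    then have D: "frechet_derivative ((\<lambda>x. H (x, q')) \<circ> inv_into U c) (at (c p')) = (\<lambda>u. ?DH y (u, 0))"
      by (rule frechet_derivative_at[symmetric])
    have lin: "linear (?DH y)" using DHd has_derivative_linear by blast
    have "(\<Sum>b\<in>Basis. X p' (\<xi> b) *\<^sub>R b, 0) = (\<Sum>b\<in>Basis. X p' (\<xi> b) *\<^sub>R (b, 0 :: 'f))"
      by (simp add: prod_eq_iff fst_sum snd_sum)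
    then have "?DH y (\<Sum>b\<in>Basis. X p' (\<xi> b) *\<^sub>R b, 0) = (\<Sum>b\<in>Basis. X p' (\<xi> b) * ?DH y (b, 0))"
      by (simp add: linear_sum[OF lin] linear_scale[OF lin] del: scaleR_Pair)
    moreover have "X p' (\<lambda>x. H (x, q')) =
        frechet_derivative ((\<lambda>x. H (x, q')) \<circ> inv_into U c) (at (c p')) (\<Sum>b\<in>Basis. X p' (\<xi> b) *\<^sub>R b)"
      by (rule M1.coordinate_expansion[OF M1.vector_field_tangent[OF X p'P(1)] c(1)
            smooth_fun_slice1[OF H p'P(2)] \<xi> \<xi>N N(1) y'(1) N(3)])
    moreover have "inv_into (U \<times> V) (map_prod c d) y = (p', q')"
      using prod_chart_inv[OF c(1) d(1), of "c p'" "d q'"] p'U y' inv by simp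
    ultimately show ?thesis using D y' inv by simp
  qed
  have "smooth_on ?S (?F \<circ> inv_into (U \<times> V) (map_prod c d))"
    by (rule smooth_on_cong[OF oS eq sm])
  moreover have "openin (mtop P) (N \<times> V)"
    using N(1) M2.chart_openin[OF d(1)] by (simp add: prod_mfd_def openin_prod_Times_iff)
  ultimately show "\<exists>W e N'. (W, e) \<in> charts P \<and> openin (mtop P) N' \<and> z \<in> N' \<and> N' \<subseteq> W \<and>
      smooth_on (e ` N') (?F \<circ> inv_into W e)"
    using prod_chart[OF c(1) d(1)] N d pq
    by (intro exI[of _ "U \<times> V"] exI[of _ "map_prod c d"] exI[of _ "N \<times> V"]) (auto simp: map_prod_image_Times)
qed

lemma smooth_fun_field_slice2:
  assumes H: "smooth_fun P H" and Y: "Y \<in> vector_fields M2"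
  shows "smooth_fun P (\<lambda>z. Y (snd z) (\<lambda>y. H (fst z, y)))"
proof -
  interpret sw: two_atlases M2 M1 by unfold_locales
  show ?thesis
    using sw.smooth_fun_swap[OF sw.smooth_fun_field_slice1[OF smooth_fun_swap[OF H] Y]] by simp
qed

section \<open>Tangent vectors and fields of the product\<close>

lemma tangent_pair_apply:
  "smooth_fun P H \<Longrightarrow> tangent_pair P (p, q) v w H = v (\<lambda>x. H (x, q)) + w (\<lambda>y. H (p, y))"
  by (simp add: tangent_pair_def differential_def o_def)

lemma tangent_pair_tangent:
  assumes pq: "p \<in> points M1" "q \<in> points M2"
    and v: "v \<in> tangent_space M1 p" and w: "w \<in> tangent_space M2 q"
  shows "tangent_pair P (p, q) v w \<in> tangent_space P (p, q)"
proof -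
  let ?t = "tangent_pair P (p, q) v w"
  have "?t (\<lambda>x. a * h x + b * k x) = a * ?t h + b * ?t k"
    if h: "smooth_fun P h" and k: "smooth_fun P k" for h k a b
  proof -
    have "smooth_fun P (\<lambda>x. a * h x + b * k x)"
      by (intro P.smooth_fun_add P.smooth_fun_mult P.smooth_fun_const h k)
    then show ?thesis
      using h k M1.tv_lincomb[OF v smooth_fun_slice1[OF h pq(2)] smooth_fun_slice1[OF k pq(2)]]
        M2.tv_lincomb[OF w smooth_fun_slice2[OF h pq(1)] smooth_fun_slice2[OF k pq(1)]]
      by (simp add: tangent_pair_apply algebra_simps)
  qed
  moreover have "?t (\<lambda>x. h x * k x) = h (p, q) * ?t k + k (p, q) * ?t h"
    if h: "smooth_fun P h" and k: "smooth_fun P k" for h k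
    using P.smooth_fun_mult[OF h k] h k
      M1.tv_mult[OF v smooth_fun_slice1[OF h pq(2)] smooth_fun_slice1[OF k pq(2)]]
      M2.tv_mult[OF w smooth_fun_slice2[OF h pq(1)] smooth_fun_slice2[OF k pq(1)]]
    by (simp add: tangent_pair_apply algebra_simps)
  moreover have "?t h = 0" if "\<not> smooth_fun P h" for h
    using that by (simp add: tangent_pair_def differential_def)
  ultimately show ?thesis unfolding tangent_space_def by simp
qed

text \<open>A function pulled back from the first factor is constant along the second slice, so
  \<open>w\<close> contributes nothing; on non-smooth functions both sides are 0 by
  convention.\<close>

lemma differential_fst_tangent_pair:
  assumes pq: "p \<in> points M1" "q \<in> points M2"
    and v: "v \<in> tangent_space M1 p" and w: "w \<in> tangent_space M2 q"
  shows "differential M1 fst (tangent_pair P (p, q) v w) = v"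
proof
  fix h
  show "differential M1 fst (tangent_pair P (p, q) v w) h = v h"
    using tangent_pair_apply[OF smooth_fun_fst, of h p q v w] M2.tv_const[OF w] M1.tv_nonsmooth[OF v]
    by (simp add: differential_def o_def)
qed

lemma differential_snd_tangent_pair:
  assumes pq: "p \<in> points M1" "q \<in> points M2"
    and v: "v \<in> tangent_space M1 p" and w: "w \<in> tangent_space M2 q"
  shows "differential M2 snd (tangent_pair P (p, q) v w) = w"
proof
  fix h
  show "differential M2 snd (tangent_pair P (p, q) v w) h = w h"
    using tangent_pair_apply[OF smooth_fun_snd, of h p q v w] M1.tv_const[OF v] M2.tv_nonsmooth[OF w]
    by (simp add: differential_def o_def)
qed

lemma differential_fst_tangent:
  assumes "v \<in> tangent_space P z"
  shows "differential M1 fst v \<in> tangent_space M1 (fst z)"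
  using P.tv_lincomb[OF assms smooth_fun_fst smooth_fun_fst] P.tv_mult[OF assms smooth_fun_fst smooth_fun_fst]
    M1.smooth_fun_add M1.smooth_fun_mult M1.smooth_fun_const
  by (simp add: tangent_space_def differential_def o_def)

lemma differential_snd_tangent:
  assumes "v \<in> tangent_space P z"
  shows "differential M2 snd v \<in> tangent_space M2 (snd z)"
  using P.tv_lincomb[OF assms smooth_fun_snd smooth_fun_snd] P.tv_mult[OF assms smooth_fun_snd smooth_fun_snd]
    M2.smooth_fun_add M2.smooth_fun_mult M2.smooth_fun_const
  by (simp add: tangent_space_def differential_def o_def)

text \<open>A tangent vector is determined by its values on the coordinates of a product chart.
  These are sums of functions pulled back from the factors, on which \<open>v\<close> acts through
  its two projections.\<close>

lemma tangent_prod_eq_zero: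
  assumes z: "z \<in> points P" and v: "v \<in> tangent_space P z"
    and fst0: "differential M1 fst v = (\<lambda>h. 0)" and snd0: "differential M2 snd v = (\<lambda>h. 0)"
  shows "v = (\<lambda>h. 0)"
proof
  fix h
  show "v h = 0"
  proof (cases "smooth_fun P h")
    case True
    obtain p q where pq: "z = (p, q)" "p \<in> points M1" "q \<in> points M2" using z by auto
    obtain U c where c: "(U, c) \<in> charts M1" "p \<in> U" using M1.chart_at[OF pq(2)] .
    obtain V d where d: "(V, d) \<in> charts M2" "q \<in> V" using M2.chart_at[OF pq(3)] .
    obtain \<xi> N where \<xi>: "\<And>b. smooth_fun M1 (\<xi> b)" and N: "openin (mtop M1) N" "p \<in> N" "N \<subseteq> U"
      and \<xi>N: "\<And>b x. x \<in> N \<Longrightarrow> \<xi> b x = c x \<bullet> b"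
      by (rule M1.coordinates_exist[OF c]) (rule that; assumption)
    obtain \<zeta> N' where \<zeta>: "\<And>b. smooth_fun M2 (\<zeta> b)" and N': "openin (mtop M2) N'" "q \<in> N'" "N' \<subseteq> V"
      and \<zeta>N: "\<And>b x. x \<in> N' \<Longrightarrow> \<zeta> b x = d x \<bullet> b"
      by (rule M2.coordinates_exist[OF d]) (rule that; assumption)
    \<comment> \<open>The inner product of a product space adds up the components, so the coordinate
      in direction \<open>b\<close> is the sum of those in directions \<open>fst b\<close> and
      \<open>snd b\<close>. For a basis vector one of these is 0, which
      \<open>coordinates_exist\<close> covers since it is stated for all directions.\<close>
    let ?\<xi> = "\<lambda>b z. \<xi> (fst b) (fst z) + \<zeta> (snd b) (snd z)"
    have sm: "smooth_fun P (?\<xi> b)" for b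
      by (intro P.smooth_fun_add smooth_fun_fst smooth_fun_snd \<xi> \<zeta>)
    have "v (?\<xi> b) = 0" for b
      using P.tv_add[OF v smooth_fun_fst[OF \<xi>[of "fst b"]] smooth_fun_snd[OF \<zeta>[of "snd b"]]]
        fun_cong[OF fst0, of "\<xi> (fst b)"] fun_cong[OF snd0, of "\<zeta> (snd b)"] \<xi> \<zeta>
      by (simp add: differential_def o_def)
    moreover have "v h = frechet_derivative (h \<circ> inv_into (U \<times> V) (map_prod c d)) (at (map_prod c d z))
        (\<Sum>b\<in>Basis. v (?\<xi> b) *\<^sub>R b)"
    proof (rule P.coordinate_expansion[OF v prod_chart[OF c(1) d(1)] True sm])
      show "openin (mtop P) (N \<times> N')"
        using N N' by (simp add: prod_mfd_def openin_prod_Times_iff)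
      show "?\<xi> b x = map_prod c d x \<bullet> b" if "x \<in> N \<times> N'" for b x
        using that \<xi>N \<zeta>N by (auto simp: inner_prod_def)
    qed (use N N' pq in auto)
    moreover have "map_prod c d z \<in> map_prod c d ` (U \<times> V)" using pq c d by blast
    then have "linear (frechet_derivative (h \<circ> inv_into (U \<times> V) (map_prod c d)) (at (map_prod c d z)))"
      by (rule has_derivative_linear[OF smooth_on_has_derivative[OF
            smooth_funD[OF prod_chart[OF c(1) d(1)] True]]])
    ultimately show ?thesis by (simp add: linear_0)
  qed (use P.tv_nonsmooth[OF v] in simp)
qed

lemma field_pair_apply:
  "smooth_fun P H \<Longrightarrow> field_pair P X Y z H = X (fst z) (\<lambda>x. H (x, snd z)) + Y (snd z) (\<lambda>y. H (fst z, y))"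
  using tangent_pair_apply[of H "fst z" "snd z"] by (simp add: field_pair_def)

lemma field_pair_vector_field:
  assumes X: "X \<in> vector_fields M1" and Y: "Y \<in> vector_fields M2"
  shows "field_pair P X Y \<in> vector_fields P"
proof -
  have "field_pair P X Y z \<in> tangent_space P z" if "z \<in> points P" for z
    using that tangent_pair_tangent[OF _ _ M1.vector_field_tangent[OF X] M2.vector_field_tangent[OF Y]]
    by (auto simp: field_pair_def)
  moreover have "smooth_fun P (\<lambda>z. field_pair P X Y z H)" if H: "smooth_fun P H" for H
    using P.smooth_fun_add[OF smooth_fun_field_slice1[OF H X] smooth_fun_field_slice2[OF H Y]]
    by (simp add: field_pair_apply[OF H])
  ultimately show ?thesis by (simp add: vector_fields_def)
qed

lemma differential_fst_field_pair:
  assumes "X \<in> vector_fields M1" "Y \<in> vector_fields M2" "p \<in> points M1" "q \<in> points M2"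
  shows "differential M1 fst (field_pair P X Y (p, q)) = X p"
  using assms differential_fst_tangent_pair M1.vector_field_tangent M2.vector_field_tangent
  by (simp add: field_pair_def)

lemma differential_snd_field_pair:
  assumes "X \<in> vector_fields M1" "Y \<in> vector_fields M2" "p \<in> points M1" "q \<in> points M2"
  shows "differential M2 snd (field_pair P X Y (p, q)) = Y q"
  using assms differential_snd_tangent_pair M1.vector_field_tangent M2.vector_field_tangent
  by (simp add: field_pair_def)

lemma field_pair_fst:
  assumes "X \<in> vector_fields M1" "Y \<in> vector_fields M2" "p \<in> points M1" "q \<in> points M2" "smooth_fun M1 h"
  shows "field_pair P X Y (p, q) (\<lambda>z. h (fst z)) = X p h"
  using field_pair_apply[OF smooth_fun_fst[OF assms(5)], of X Y "(p, q)"]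
    M2.tv_const[OF M2.vector_field_tangent[OF assms(2,4)]] by simp

lemma field_pair_snd:
  assumes "X \<in> vector_fields M1" "Y \<in> vector_fields M2" "p \<in> points M1" "q \<in> points M2" "smooth_fun M2 h"
  shows "field_pair P X Y (p, q) (\<lambda>z. h (snd z)) = Y q h"
  using field_pair_apply[OF smooth_fun_snd[OF assms(5)], of X Y "(p, q)"]
    M1.tv_const[OF M1.vector_field_tangent[OF assms(1,3)]] by simp

text \<open>Only the projections of the bracket enter the metric, so the cross terms \<open>[X, V]\<close> and their
  symmetry of mixed second derivatives never arise.\<close>

lemma differential_fst_bracket:
  assumes X: "X \<in> vector_fields M1" "X' \<in> vector_fields M1" and Y: "Y \<in> vector_fields M2" "Y' \<in> vector_fields M2"
    and pq: "p \<in> points M1" "q \<in> points M2"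
  shows "differential M1 fst (bracket P (field_pair P X Y) (field_pair P X' Y') (p, q)) = bracket M1 X X' p"
proof
  fix h
  have *: "field_pair P X Y (p, q) (\<lambda>z. field_pair P X' Y' z (\<lambda>z. h (fst z))) = X p (\<lambda>x. X' x h)"
    if X: "X \<in> vector_fields M1" "X' \<in> vector_fields M1" and Y: "Y \<in> vector_fields M2" "Y' \<in> vector_fields M2"
      and h: "smooth_fun M1 h" for X X' Y Y'
  proof -
    \<comment> \<open>The inner functions agree only on the carrier of the product, hence
      \<open>tv_cong\<close>.\<close>
    have "field_pair P X Y (p, q) (\<lambda>z. field_pair P X' Y' z (\<lambda>z. h (fst z))) =
        field_pair P X Y (p, q) (\<lambda>z. (\<lambda>x. X' x h) (fst z))"
      by (rule P.tv_cong)
        (use field_pair_vector_field X Y pq P.vector_field_tangent field_pair_fst[OF X(2) Y(2) _ _ h]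
          P.vector_field_smooth[OF field_pair_vector_field[OF X(2) Y(2)] smooth_fun_fst[OF h]] in auto)
    then show ?thesis
      using field_pair_fst[OF X(1) Y(1) pq M1.vector_field_smooth[OF X(2) h]] by simp
  qed
  show "differential M1 fst (bracket P (field_pair P X Y) (field_pair P X' Y') (p, q)) h = bracket M1 X X' p h"
    using *[OF X Y] *[OF X(2,1) Y(2,1)] smooth_fun_fst
    by (simp add: differential_def bracket_def o_def)
qed

lemma differential_snd_bracket:
  assumes X: "X \<in> vector_fields M1" "X' \<in> vector_fields M1" and Y: "Y \<in> vector_fields M2" "Y' \<in> vector_fields M2"
    and pq: "p \<in> points M1" "q \<in> points M2"
  shows "differential M2 snd (bracket P (field_pair P X Y) (field_pair P X' Y') (p, q)) = bracket M2 Y Y' q"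
proof
  fix h
  have *: "field_pair P X Y (p, q) (\<lambda>z. field_pair P X' Y' z (\<lambda>z. h (snd z))) = Y q (\<lambda>y. Y' y h)"
    if X: "X \<in> vector_fields M1" "X' \<in> vector_fields M1" and Y: "Y \<in> vector_fields M2" "Y' \<in> vector_fields M2"
      and h: "smooth_fun M2 h" for X X' Y Y'
  proof -
    have "field_pair P X Y (p, q) (\<lambda>z. field_pair P X' Y' z (\<lambda>z. h (snd z))) =
        field_pair P X Y (p, q) (\<lambda>z. (\<lambda>y. Y' y h) (snd z))"
      by (rule P.tv_cong)
        (use field_pair_vector_field X Y pq P.vector_field_tangent field_pair_snd[OF X(2) Y(2) _ _ h]
          P.vector_field_smooth[OF field_pair_vector_field[OF X(2) Y(2)] smooth_fun_snd[OF h]] in auto)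
    then show ?thesis
      using field_pair_snd[OF X(1) Y(1) pq M2.vector_field_smooth[OF Y(2) h]] by simp
  qed
  show "differential M2 snd (bracket P (field_pair P X Y) (field_pair P X' Y') (p, q)) h = bracket M2 Y Y' q h"
    using *[OF X Y] *[OF X(2,1) Y(2,1)] smooth_fun_snd
    by (simp add: differential_def bracket_def o_def)
qed

end

section \<open>The Koszul formula for the product metric\<close>

text \<open>What the Koszul formula uses of a metric at one point; for the product metric it follows
  directly from linearity of the projections.\<close>

definition symmetric_bilinear :: "('a, 'e::euclidean_space) mfd \<Rightarrow> 'a form2 \<Rightarrow> 'a \<Rightarrow> bool" where
  "symmetric_bilinear M g p \<longleftrightarrow>
     (\<forall>u\<in>tangent_space M p. \<forall>v\<in>tangent_space M p. \<forall>w\<in>tangent_space M p. \<forall>a b.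
        g p (\<lambda>h. a * u h + b * v h) w = a * g p u w + b * g p v w) \<and>
     (\<forall>v\<in>tangent_space M p. \<forall>w\<in>tangent_space M p. g p v w = g p w v)"

lemma symmetric_bilinear_lincomb:
  assumes "symmetric_bilinear M g p" "u \<in> tangent_space M p" "v \<in> tangent_space M p" "w \<in> tangent_space M p"
  shows "g p (\<lambda>h. a * u h + b * v h) w = a * g p u w + b * g p v w"
  using assms unfolding symmetric_bilinear_def by blast

lemma symmetric_bilinear_diff:
  assumes "symmetric_bilinear M g p" "u \<in> tangent_space M p" "v \<in> tangent_space M p" "w \<in> tangent_space M p"
  shows "g p (\<lambda>h. u h - v h) w = g p u w - g p v w"
  using symmetric_bilinear_lincomb[OF assms, of 1 "-1"] by simp

lemma symmetric_bilinear_sym: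
  assumes "symmetric_bilinear M g p" "v \<in> tangent_space M p" "w \<in> tangent_space M p"
  shows "g p v w = g p w v"
  using assms unfolding symmetric_bilinear_def by blast

lemma symmetric_bilinear_zero:
  assumes "symmetric_bilinear M g p" "v \<in> tangent_space M p"
  shows "g p (\<lambda>h. 0) v = 0"
  using symmetric_bilinear_lincomb[OF assms(1,2,2,2), of 0 0] by simp

lemma riemannian_metric_symmetric_bilinear:
  assumes "riemannian_metric M g" "p \<in> points M"
  shows "symmetric_bilinear M g p"
  using assms unfolding riemannian_metric_def symmetric_bilinear_def by blast

lemma riemannian_metric_smooth:
  assumes "riemannian_metric M g" "X \<in> vector_fields M" "Y \<in> vector_fields M"
  shows "smooth_fun M (\<lambda>p. g p (X p) (Y p))"
  using assms unfolding riemannian_metric_def by blast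

lemma riemannian_metric_pos:
  assumes "riemannian_metric M g" "p \<in> points M" "v \<in> tangent_space M p" "v \<noteq> (\<lambda>h. 0)"
  shows "g p v v > 0"
  using assms unfolding riemannian_metric_def by blast

lemma riemannian_metric_nonneg:
  assumes "riemannian_metric M g" "p \<in> points M" "v \<in> tangent_space M p"
  shows "g p v v \<ge> 0"
  using riemannian_metric_pos[OF assms]
    symmetric_bilinear_zero[OF riemannian_metric_symmetric_bilinear[OF assms(1,2)] assms(3)]
  by (cases "v = (\<lambda>h. 0)") auto

lemma one_form_lincomb:
  assumes "one_form M \<eta>" "p \<in> points M" "v \<in> tangent_space M p" "w \<in> tangent_space M p"
  shows "\<eta> p (\<lambda>h. a * v h + b * w h) = a * \<eta> p v + b * \<eta> p w"
  using assms unfolding one_form_def by blast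

lemma one_form_smooth:
  assumes "one_form M \<eta>" "X \<in> vector_fields M"
  shows "smooth_fun M (\<lambda>p. \<eta> p (X p))"
  using assms unfolding one_form_def by blast

lemma endo_field_field:
  assumes "endo_field M J" "X \<in> vector_fields M"
  shows "(\<lambda>p. J p (X p)) \<in> vector_fields M"
  using assms unfolding endo_field_def by blast

lemma endo_field_lincomb:
  assumes "endo_field M J" "p \<in> points M" "v \<in> tangent_space M p" "w \<in> tangent_space M p"
  shows "J p (\<lambda>h. a * v h + b * w h) = (\<lambda>h. a * J p v h + b * J p w h)"
  using assms unfolding endo_field_def by blast

lemma levi_civita_field:
  assumes "levi_civita M g D" "X \<in> vector_fields M" "Y \<in> vector_fields M"
  shows "D X Y \<in> vector_fields M"
  using conjunct1[OF conjunct1[OF assms(1)[unfolded levi_civita_def], unfolded affine_connection_def]] assms(2,3)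
  by simp

lemma levi_civita_torsion_free:
  assumes "levi_civita M g D" "X \<in> vector_fields M" "Y \<in> vector_fields M" "p \<in> points M"
  shows "bracket M X Y p = (\<lambda>h. D X Y p h - D Y X p h)"
  using assms unfolding levi_civita_def by blast

lemma levi_civita_metric:
  assumes "levi_civita M g D" "X \<in> vector_fields M" "Y \<in> vector_fields M" "Z \<in> vector_fields M"
    "p \<in> points M"
  shows "X p (\<lambda>x. g x (Y x) (Z x)) = g p (D X Y p) (Z p) + g p (Y p) (D X Z p)"
  using assms unfolding levi_civita_def by blast

text \<open>Add metric compatibility along \<open>A\<close> and \<open>B\<close>, subtract it along
  \<open>C\<close>, and replace the resulting differences of covariant derivatives by
  brackets.\<close>

lemma koszul:
  assumes lc: "levi_civita M g D" and g: "symmetric_bilinear M g p"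
    and A: "A \<in> vector_fields M" and B: "B \<in> vector_fields M" and C: "C \<in> vector_fields M"
    and p: "p \<in> points M"
  shows "2 * g p (D A B p) (C p) =
      A p (\<lambda>x. g x (B x) (C x)) + B p (\<lambda>x. g x (A x) (C x)) - C p (\<lambda>x. g x (A x) (B x))
      + g p (bracket M A B p) (C p) - g p (bracket M A C p) (B p) - g p (bracket M B C p) (A p)"
proof -
  have T: "X p \<in> tangent_space M p" if "X \<in> vector_fields M" for X
    using that p unfolding vector_fields_def by blast
  have DT: "D X Y p \<in> tangent_space M p" if "X \<in> vector_fields M" "Y \<in> vector_fields M" for X Y
    by (rule T[OF levi_civita_field[OF lc that]])
  have br: "g p (bracket M X Y p) (Z p) = g p (D X Y p) (Z p) - g p (D Y X p) (Z p)"
    if "X \<in> vector_fields M" "Y \<in> vector_fields M" "Z \<in> vector_fields M" for X Y Z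
    using levi_civita_torsion_free[OF lc that(1,2) p]
      symmetric_bilinear_diff[OF g DT[OF that(1,2)] DT[OF that(2,1)] T[OF that(3)]] by simp
  \<comment> \<open>Symmetry moves every covariant derivative to the first slot, so that the six
    instances below combine by linear arithmetic.\<close>
  have m: "X p (\<lambda>x. g x (Y x) (Z x)) = g p (D X Y p) (Z p) + g p (D X Z p) (Y p)"
    if "X \<in> vector_fields M" "Y \<in> vector_fields M" "Z \<in> vector_fields M" for X Y Z
    using levi_civita_metric[OF lc that p] symmetric_bilinear_sym[OF g T[OF that(2)] DT[OF that(1,3)]]
    by simp
  show ?thesis
    using m[OF A B C] m[OF B A C] m[OF C A B] br[OF A B C] br[OF A C B] br[OF B C A] by simp
qed

context hausdorff_atlas
begin

lemma bracket_zero_right: "X \<in> vector_fields M \<Longrightarrow> p \<in> points M \<Longrightarrow> bracket M X zero_field p = zero_field p"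
  using tv_const[OF vector_field_tangent] by (auto simp: bracket_def zero_field_def)

lemma bracket_zero_left: "X \<in> vector_fields M \<Longrightarrow> p \<in> points M \<Longrightarrow> bracket M zero_field X p = zero_field p"
  using tv_const[OF vector_field_tangent] by (auto simp: bracket_def zero_field_def)

lemma one_form_zero_field: "one_form M \<eta> \<Longrightarrow> p \<in> points M \<Longrightarrow> \<eta> p (zero_field p) = 0"
  using one_form_lincomb[of M \<eta> p "\<lambda>h. 0" "\<lambda>h. 0" 0 0] tangent_space_zero by (simp add: zero_field_def)

lemma metric_zero_field:
  assumes "riemannian_metric M g" "p \<in> points M" "v \<in> tangent_space M p"
  shows "g p (zero_field p) v = 0" "g p v (zero_field p) = 0"
  using symmetric_bilinear_zero[OF riemannian_metric_symmetric_bilinear[OF assms(1,2)] assms(3)]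
    symmetric_bilinear_sym[OF riemannian_metric_symmetric_bilinear[OF assms(1,2)] assms(3) tangent_space_zero]
  by (simp_all add: zero_field_def)

end

section \<open>The terms of the Koszul formula on pairs of fields\<close>

locale product_structure = two_atlases M1 M2
  for M1 :: "('a, 'e::euclidean_space) mfd" and M2 :: "('b, 'f::euclidean_space) mfd" +
  fixes \<alpha> :: real and f :: "'a \<Rightarrow> real" and \<omega> :: "'a form1" and g1 :: "'a form2"
    and \<eta> :: "'b form1" and g2 :: "'b form2"
  assumes omega: "one_form M1 \<omega>" and g1: "riemannian_metric M1 g1"
    and eta: "one_form M2 \<eta>" and g2: "riemannian_metric M2 g2" and f: "smooth_fun M1 f"
begin

abbreviation g :: "('a \<times> 'b) form2" where
  "g \<equiv> product_metric M1 M2 \<alpha> f \<omega> g1 \<eta> g2"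

lemma metric_tangent_pair:
  assumes pq: "p \<in> points M1" "q \<in> points M2"
    and v: "v \<in> tangent_space M1 p" "v' \<in> tangent_space M1 p"
    and w: "w \<in> tangent_space M2 q" "w' \<in> tangent_space M2 q"
  shows "g (p, q) (tangent_pair P (p, q) v w) (tangent_pair P (p, q) v' w') =
    g1 p v v' + (f p)\<^sup>2 * (g2 q w w' - \<eta> q w * \<eta> q w')
    + (\<alpha> * \<omega> p v + \<eta> q w) * (\<alpha> * \<omega> p v' + \<eta> q w')"
  using differential_fst_tangent_pair[OF pq v(1) w(1)] differential_snd_tangent_pair[OF pq v(1) w(1)]
    differential_fst_tangent_pair[OF pq v(2) w(2)] differential_snd_tangent_pair[OF pq v(2) w(2)]
  by (simp add: product_metric_def eta_bar_def)

lemma metric_field_pair: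
  assumes X: "X \<in> vector_fields M1" "X' \<in> vector_fields M1" and Y: "Y \<in> vector_fields M2" "Y' \<in> vector_fields M2"
    and pq: "p \<in> points M1" "q \<in> points M2"
  shows "g (p, q) (field_pair P X Y (p, q)) (field_pair P X' Y' (p, q)) =
    g1 p (X p) (X' p) + (f p)\<^sup>2 * (g2 q (Y q) (Y' q) - \<eta> q (Y q) * \<eta> q (Y' q))
    + (\<alpha> * \<omega> p (X p) + \<eta> q (Y q)) * (\<alpha> * \<omega> p (X' p) + \<eta> q (Y' q))"
  using metric_tangent_pair[OF pq] M1.vector_field_tangent M2.vector_field_tangent X Y pq
  by (simp add: field_pair_def)

lemma metric_bracket_field_pair:
  assumes X: "X \<in> vector_fields M1" "X' \<in> vector_fields M1" "X'' \<in> vector_fields M1"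
    and Y: "Y \<in> vector_fields M2" "Y' \<in> vector_fields M2" "Y'' \<in> vector_fields M2"
    and pq: "p \<in> points M1" "q \<in> points M2"
  shows "g (p, q) (bracket P (field_pair P X Y) (field_pair P X' Y') (p, q)) (field_pair P X'' Y'' (p, q)) =
    g1 p (bracket M1 X X' p) (X'' p)
    + (f p)\<^sup>2 * (g2 q (bracket M2 Y Y' q) (Y'' q) - \<eta> q (bracket M2 Y Y' q) * \<eta> q (Y'' q))
    + (\<alpha> * \<omega> p (bracket M1 X X' p) + \<eta> q (bracket M2 Y Y' q)) * (\<alpha> * \<omega> p (X'' p) + \<eta> q (Y'' q))"
  using differential_fst_bracket[OF X(1,2) Y(1,2) pq] differential_snd_bracket[OF X(1,2) Y(1,2) pq]
    differential_fst_field_pair[OF X(3) Y(3) pq] differential_snd_field_pair[OF X(3) Y(3) pq]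
  by (simp add: product_metric_def eta_bar_def)

text \<open>On pairs the metric is built by sums and products from functions of one factor each. The
  Leibniz rule reduces its derivative to derivatives of such functions, and on these the pair acts
  by the component belonging to that factor.\<close>

lemma metric_derivative:
  assumes X: "X \<in> vector_fields M1" "X' \<in> vector_fields M1" "Z \<in> vector_fields M1"
    and Y: "Y \<in> vector_fields M2" "Y' \<in> vector_fields M2" "W \<in> vector_fields M2"
    and pq: "p \<in> points M1" "q \<in> points M2"
  shows "field_pair P Z W (p, q) (\<lambda>z. g z (field_pair P X Y z) (field_pair P X' Y' z)) =
    Z p (\<lambda>x. g1 x (X x) (X' x))
    + 2 * f p * Z p f * (g2 q (Y q) (Y' q) - \<eta> q (Y q) * \<eta> q (Y' q))
    + (f p)\<^sup>2 * (W q (\<lambda>y. g2 y (Y y) (Y' y))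
        - \<eta> q (Y q) * W q (\<lambda>y. \<eta> y (Y' y)) - \<eta> q (Y' q) * W q (\<lambda>y. \<eta> y (Y y)))
    + (\<alpha> * Z p (\<lambda>x. \<omega> x (X x)) + W q (\<lambda>y. \<eta> y (Y y))) * (\<alpha> * \<omega> p (X' p) + \<eta> q (Y' q))
    + (\<alpha> * \<omega> p (X p) + \<eta> q (Y q)) * (\<alpha> * Z p (\<lambda>x. \<omega> x (X' x)) + W q (\<lambda>y. \<eta> y (Y' y)))"
proof -
  let ?C = "field_pair P Z W (p, q)"
  have C: "?C \<in> tangent_space P (p, q)"
    using P.vector_field_tangent[OF field_pair_vector_field[OF X(3) Y(3)]] pq by simp
  have Zp: "Z p \<in> tangent_space M1 p" and Wq: "W q \<in> tangent_space M2 q"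
    using M1.vector_field_tangent[OF X(3) pq(1)] M2.vector_field_tangent[OF Y(3) pq(2)] .
  define a where "a x = g1 x (X x) (X' x)" for x
  define b where "b y = g2 y (Y y) (Y' y) - \<eta> y (Y y) * \<eta> y (Y' y)" for y
  define s where "s x = \<alpha> * \<omega> x (X x)" for x
  define s' where "s' x = \<alpha> * \<omega> x (X' x)" for x
  define t where "t y = \<eta> y (Y y)" for y
  define t' where "t' y = \<eta> y (Y' y)" for y
  define k where "k x = f x * f x" for x
  note \<omega>X = one_form_smooth[OF omega X(1)] one_form_smooth[OF omega X(2)]
  have sm1: "smooth_fun M1 a" "smooth_fun M1 s" "smooth_fun M1 s'" "smooth_fun M1 k"
    unfolding a_def s_def s'_def k_def
    by (intro M1.smooth_fun_mult M1.smooth_fun_const \<omega>X f riemannian_metric_smooth[OF g1] X)+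
  have sm2: "smooth_fun M2 t" "smooth_fun M2 t'" "smooth_fun M2 (\<lambda>y. g2 y (Y y) (Y' y))"
    unfolding t_def t'_def
    by (intro one_form_smooth[OF eta] riemannian_metric_smooth[OF g2] Y)+
  have b: "b = (\<lambda>y. g2 y (Y y) (Y' y) - t y * t' y)" by (simp add: fun_eq_iff b_def t_def t'_def)
  have smb: "smooth_fun M2 b"
    unfolding b by (intro M2.smooth_fun_diff M2.smooth_fun_mult sm2)
  note f1 = smooth_fun_fst[OF sm1(1)] smooth_fun_fst[OF sm1(2)] smooth_fun_fst[OF sm1(3)] smooth_fun_fst[OF sm1(4)]
  note f2 = smooth_fun_snd[OF sm2(1)] smooth_fun_snd[OF sm2(2)] smooth_fun_snd[OF smb]
  note add = P.smooth_fun_add and mul = P.smooth_fun_mult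
  let ?F = "\<lambda>z. (a (fst z) + k (fst z) * b (snd z)) + (s (fst z) + t (snd z)) * (s' (fst z) + t' (snd z))"
  have F: "smooth_fun P ?F" by (intro add mul f1 f2)
  have eq: "?F z = g z (field_pair P X Y z) (field_pair P X' Y' z)" if "z \<in> points P" for z
    using metric_field_pair[OF X(1,2) Y(1,2), of "fst z" "snd z"] that
    by (simp add: a_def k_def b_def s_def s'_def t_def t'_def power2_eq_square mem_Times_iff)
  have "?C (\<lambda>z. g z (field_pair P X Y z) (field_pair P X' Y' z)) = ?C ?F"
    using P.tv_cong[OF C F _ eq] pq by simp
  also have "\<dots> = ?C (\<lambda>z. a (fst z)) + (k p * ?C (\<lambda>z. b (snd z)) + b q * ?C (\<lambda>z. k (fst z)))
      + ((s p + t q) * (?C (\<lambda>z. s' (fst z)) + ?C (\<lambda>z. t' (snd z)))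
        + (s' p + t' q) * (?C (\<lambda>z. s (fst z)) + ?C (\<lambda>z. t (snd z))))"
    by (simp add: P.tv_add[OF C] P.tv_mult[OF C] add mul f1 f2)
  also have "\<dots> = Z p a + (k p * W q b + b q * Z p k)
      + ((s p + t q) * (Z p s' + W q t') + (s' p + t' q) * (Z p s + W q t))"
    using field_pair_fst[OF X(3) Y(3) pq] field_pair_snd[OF X(3) Y(3) pq] sm1 sm2 smb by simp
  also have "Z p k = 2 * f p * Z p f"
    using M1.tv_mult[OF Zp f f] by (simp add: k_def[abs_def])
  also have "W q b = W q (\<lambda>y. g2 y (Y y) (Y' y)) - (t q * W q t' + t' q * W q t)"
    unfolding b by (simp add: M2.tv_diff[OF Wq] M2.tv_mult[OF Wq] M2.smooth_fun_mult sm2)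
  also have "Z p s = \<alpha> * Z p (\<lambda>x. \<omega> x (X x))"
    unfolding s_def by (rule M1.tv_cmult[OF Zp \<omega>X(1)])
  also have "Z p s' = \<alpha> * Z p (\<lambda>x. \<omega> x (X' x))"
    unfolding s'_def by (rule M1.tv_cmult[OF Zp \<omega>X(2)])
  finally show ?thesis
    by (simp add: a_def[abs_def] k_def b_def s_def s'_def t_def[abs_def] t'_def[abs_def]
        power2_eq_square algebra_simps)
qed

lemma metric_symmetric_bilinear:
  assumes "z \<in> points P"
  shows "symmetric_bilinear P g z"
proof -
  obtain p q where z: "z = (p, q)" "p \<in> points M1" "q \<in> points M2" using assms by auto
  note b1 = riemannian_metric_symmetric_bilinear[OF g1 z(2)]
  note b2 = riemannian_metric_symmetric_bilinear[OF g2 z(3)]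
  note d1 = differential_fst_tangent[of _ "(p, q)", simplified]
  note d2 = differential_snd_tangent[of _ "(p, q)", simplified]
  have D1: "differential M1 fst (\<lambda>h. a * u h + b * v h) =
      (\<lambda>h. a * differential M1 fst u h + b * differential M1 fst v h)" for a b and u v :: "('a \<times> 'b) tvec"
    by (auto simp: differential_def)
  have D2: "differential M2 snd (\<lambda>h. a * u h + b * v h) =
      (\<lambda>h. a * differential M2 snd u h + b * differential M2 snd v h)" for a b and u v :: "('a \<times> 'b) tvec"
    by (auto simp: differential_def)
  have "g (p, q) (\<lambda>h. a * u h + b * v h) w = a * g (p, q) u w + b * g (p, q) v w"
    if u: "u \<in> tangent_space P (p, q)" and v: "v \<in> tangent_space P (p, q)"
      and w: "w \<in> tangent_space P (p, q)" for u v w a b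
    unfolding product_metric_def eta_bar_def D1 D2
    using symmetric_bilinear_lincomb[OF b1 d1[OF u] d1[OF v] d1[OF w], of a b]
      symmetric_bilinear_lincomb[OF b2 d2[OF u] d2[OF v] d2[OF w], of a b]
      one_form_lincomb[OF omega z(2) d1[OF u] d1[OF v], of a b]
      one_form_lincomb[OF eta z(3) d2[OF u] d2[OF v], of a b]
    by (simp add: algebra_simps)
  moreover have "g (p, q) v w = g (p, q) w v"
    if v: "v \<in> tangent_space P (p, q)" and w: "w \<in> tangent_space P (p, q)" for v w
    unfolding product_metric_def
    using symmetric_bilinear_sym[OF b1 d1[OF v] d1[OF w]] symmetric_bilinear_sym[OF b2 d2[OF v] d2[OF w]]
    by simp
  ultimately show ?thesis unfolding z symmetric_bilinear_def by blast
qed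

end

section \<open>Pointwise identities of the two structures\<close>

lemma almost_hermitianD:
  assumes "almost_hermitian M J g"
  shows "smooth_manifold M" "endo_field M J" "riemannian_metric M g"
    "X \<in> vector_fields M \<Longrightarrow> p \<in> points M \<Longrightarrow> J p (J p (X p)) = (\<lambda>h. - X p h)"
    "X \<in> vector_fields M \<Longrightarrow> Y \<in> vector_fields M \<Longrightarrow> p \<in> points M \<Longrightarrow>
      g p (J p (X p)) (J p (Y p)) = g p (X p) (Y p)"
  using assms unfolding almost_hermitian_def by blast+

lemma almost_contact_metricD:
  assumes "almost_contact_metric M \<phi> \<xi> \<eta> g"
  shows "smooth_manifold M" "endo_field M \<phi>" "\<xi> \<in> vector_fields M" "one_form M \<eta>" "riemannian_metric M g"
    "U \<in> vector_fields M \<Longrightarrow> p \<in> points M \<Longrightarrow> \<phi> p (\<phi> p (U p)) = (\<lambda>h. - U p h + \<eta> p (U p) * \<xi> p h)"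
    "p \<in> points M \<Longrightarrow> \<eta> p (\<xi> p) = 1"
    "U \<in> vector_fields M \<Longrightarrow> V \<in> vector_fields M \<Longrightarrow> p \<in> points M \<Longrightarrow>
      g p (\<phi> p (U p)) (\<phi> p (V p)) = g p (U p) (V p) - \<eta> p (U p) * \<eta> p (V p)"
  using assms unfolding almost_contact_metric_def by blast+

text \<open>Apply \<open>J\<close> to both arguments and use that \<open>J\<close> squares to minus
  the identity.\<close>

lemma almost_hermitian_skew:
  assumes ah: "almost_hermitian M J g" and X: "X \<in> vector_fields M" and Y: "Y \<in> vector_fields M"
    and p: "p \<in> points M"
  shows "g p (X p) (J p (Y p)) = - g p (J p (X p)) (Y p)"
proof -
  note sm = almost_hermitianD(1)[OF ah] and J = almost_hermitianD(2)[OF ah] and g = almost_hermitianD(3)[OF ah]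
  interpret hausdorff_atlas M by (rule smooth_manifold_imp_hausdorff_atlas[OF sm])
  note b = riemannian_metric_symmetric_bilinear[OF g p]
  have JX: "J p (X p) \<in> tangent_space M p" and Yp: "Y p \<in> tangent_space M p"
    using vector_field_tangent[OF endo_field_field[OF J X] p] vector_field_tangent[OF Y p] .
  have JJ: "J p (J p (Y p)) = (\<lambda>h. - Y p h)" by (rule almost_hermitianD(4)[OF ah Y p])
  have mY: "(\<lambda>h. - Y p h) \<in> tangent_space M p"
    using tangent_space_lincomb[OF Yp Yp, of "-1" 0] by simp
  have "g p (X p) (J p (Y p)) = g p (J p (X p)) (J p (J p (Y p)))"
    using almost_hermitianD(5)[OF ah X endo_field_field[OF J Y] p] by simp
  also have "\<dots> = g p (J p (X p)) (\<lambda>h. - Y p h)" using JJ by simp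
  also have "\<dots> = g p (\<lambda>h. - Y p h) (J p (X p))" by (rule symmetric_bilinear_sym[OF b JX mY])
  also have "\<dots> = - g p (Y p) (J p (X p))"
    using symmetric_bilinear_lincomb[OF b Yp Yp JX, of "-1" 0] by simp
  also have "\<dots> = - g p (J p (X p)) (Y p)" using symmetric_bilinear_sym[OF b JX Yp] by simp
  finally show ?thesis .
qed

text \<open>Put E = \<phi> \<xi>. The axiom for the square of \<phi> at \<xi> gives \<phi> E = 0,
  and at E it gives E = r \<xi> with r = \<eta>(E). Applying \<phi> once more yields r E = 0, and
  both r = 0 and E = 0 lead to E = 0.\<close>

lemma almost_contact_phi_xi:
  assumes ac: "almost_contact_metric M \<phi> \<xi> \<eta> g" and q: "q \<in> points M"
  shows "\<phi> q (\<xi> q) = (\<lambda>h. 0)"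
proof -
  note sm = almost_contact_metricD(1)[OF ac] and \<phi> = almost_contact_metricD(2)[OF ac]
    and \<xi> = almost_contact_metricD(3)[OF ac] and sq = almost_contact_metricD(6)[OF ac _ q]
    and \<eta>\<xi> = almost_contact_metricD(7)[OF ac q]
  interpret hausdorff_atlas M by (rule smooth_manifold_imp_hausdorff_atlas[OF sm])
  let ?E = "\<phi> q (\<xi> q)" and ?r = "\<eta> q (\<phi> q (\<xi> q))"
  have \<xi>q: "\<xi> q \<in> tangent_space M q" by (rule vector_field_tangent[OF \<xi> q])
  have lin: "\<phi> q (\<lambda>h. a * \<xi> q h) = (\<lambda>h. a * ?E h)" for a
    using endo_field_lincomb[OF \<phi> q \<xi>q \<xi>q, of a 0] by simp
  have \<phi>E: "\<phi> q ?E = (\<lambda>h. 0)" using sq[OF \<xi>] \<eta>\<xi> by simp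
  moreover have "\<phi> q (\<phi> q ?E) = (\<lambda>h. - ?E h + ?r * \<xi> q h)"
    using sq[OF endo_field_field[OF \<phi> \<xi>]] .
  moreover have "\<phi> q (\<lambda>h. 0) = (\<lambda>h. 0)" using lin[of 0] by simp
  ultimately have "(\<lambda>h. 0) = (\<lambda>h. - ?E h + ?r * \<xi> q h)" by simp
  then have E: "?E h = ?r * \<xi> q h" for h
    using fun_cong[of "\<lambda>h. 0" "\<lambda>h. - ?E h + ?r * \<xi> q h" h] by simp
  then have "?E = (\<lambda>h. ?r * \<xi> q h)" by (rule ext)
  then have "(\<lambda>h. 0) = (\<lambda>h. ?r * ?E h)" using \<phi>E lin[of ?r] by simp
  then have "?r * ?E h = 0" for h using fun_cong[of "\<lambda>h. 0" "\<lambda>h. ?r * ?E h" h] by simp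
  then have "?r = 0 \<or> ?E h = 0" for h by simp
  then show ?thesis using E by (cases "?r = 0") (auto simp: fun_eq_iff)
qed

text \<open>Metric compatibility with \<xi> in the first slot, where the left side vanishes because
  \<phi> \<xi> = 0.\<close>

lemma almost_contact_metric_xi:
  assumes ac: "almost_contact_metric M \<phi> \<xi> \<eta> g" and q: "q \<in> points M" and W: "W \<in> vector_fields M"
  shows "g q (\<xi> q) (W q) = \<eta> q (W q)"
proof -
  note sm = almost_contact_metricD(1)[OF ac] and \<phi> = almost_contact_metricD(2)[OF ac]
    and \<xi> = almost_contact_metricD(3)[OF ac] and g = almost_contact_metricD(5)[OF ac]
    and \<eta>\<xi> = almost_contact_metricD(7)[OF ac q]
  interpret hausdorff_atlas M by (rule smooth_manifold_imp_hausdorff_atlas[OF sm])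
  have "g q (\<phi> q (\<xi> q)) (\<phi> q (W q)) = g q (\<xi> q) (W q) - \<eta> q (\<xi> q) * \<eta> q (W q)"
    by (rule almost_contact_metricD(8)[OF ac \<xi> W q])
  moreover have "g q (\<phi> q (\<xi> q)) (\<phi> q (W q)) = 0"
    using symmetric_bilinear_zero[OF riemannian_metric_symmetric_bilinear[OF g q]
        vector_field_tangent[OF endo_field_field[OF \<phi> W] q]] almost_contact_phi_xi[OF ac q] by simp
  ultimately show ?thesis using \<eta>\<xi> by simp
qed

context product_structure
begin

lemma metric_definite:
  assumes ac: "almost_contact_metric M2 \<phi> \<xi> \<eta> g2" and f_pos: "\<forall>p\<in>points M1. f p > 0"
    and z: "z \<in> points P" and v: "v \<in> tangent_space P z" and null: "g z v v = 0"
  shows "v = (\<lambda>h. 0)"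
proof -
  obtain p q where pq: "z = (p, q)" "p \<in> points M1" "q \<in> points M2" using z by auto
  let ?v1 = "differential M1 fst v" and ?v2 = "differential M2 snd v"
  have v1: "?v1 \<in> tangent_space M1 p" and v2: "?v2 \<in> tangent_space M2 q"
    using differential_fst_tangent[OF v] differential_snd_tangent[OF v] pq by simp_all
  obtain W where W: "W \<in> vector_fields M2" "W q = ?v2" using M2.vector_field_through[OF pq(3) v2] .
  note \<phi> = almost_contact_metricD(2)[OF ac]
  have \<phi>W: "\<phi> q ?v2 \<in> tangent_space M2 q"
    using M2.vector_field_tangent[OF endo_field_field[OF \<phi> W(1)] pq(3)] W(2) by simp
  have \<phi>g: "g2 q (\<phi> q ?v2) (\<phi> q ?v2) = g2 q ?v2 ?v2 - \<eta> q ?v2 * \<eta> q ?v2"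
    using almost_contact_metricD(8)[OF ac W(1) W(1) pq(3)] W(2) by simp
  have sq: "\<phi> q (\<phi> q ?v2) = (\<lambda>h. - ?v2 h + \<eta> q ?v2 * \<xi> q h)"
    using almost_contact_metricD(6)[OF ac W(1) pq(3)] W(2) by simp
  let ?a = "g1 p ?v1 ?v1" and ?b = "g2 q (\<phi> q ?v2) (\<phi> q ?v2)" and ?c = "\<alpha> * \<omega> p ?v1 + \<eta> q ?v2"
  \<comment> \<open>Writing the part of \<open>g2\<close> transverse to \<xi> as \<open>?b\<close>
    turns the metric into a sum of three nonnegative terms, each of which must vanish; positivity of
    \<open>f\<close> then frees \<open>?b\<close> from its factor.\<close>
  have sum: "?a + (f p)\<^sup>2 * ?b + ?c\<^sup>2 = 0"
    using null unfolding \<phi>g by (simp add: pq product_metric_def eta_bar_def power2_eq_square)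
  have "?a \<ge> 0" "?b \<ge> 0"
    using riemannian_metric_nonneg[OF g1 pq(2) v1] riemannian_metric_nonneg[OF g2 pq(3) \<phi>W] .
  then have "(f p)\<^sup>2 * ?b \<ge> 0" by simp
  then have "?a = 0" "(f p)\<^sup>2 * ?b = 0" "?c\<^sup>2 = 0"
    using sum \<open>?a \<ge> 0\<close> zero_le_power2[of ?c] by linarith+
  then have a: "?a = 0" and b: "?b = 0" and c: "?c = 0" using bspec[OF f_pos pq(2)] by auto
  have v1_0: "?v1 = (\<lambda>h. 0)" using riemannian_metric_pos[OF g1 pq(2) v1] a by fastforce
  have \<phi>0: "\<phi> q ?v2 = (\<lambda>h. 0)" using riemannian_metric_pos[OF g2 pq(3) \<phi>W] b by fastforce
  have "\<omega> p (\<lambda>h. 0) = 0" using M1.one_form_zero_field[OF omega pq(2)] by (simp add: zero_field_def)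
  then have eta0: "\<eta> q ?v2 = 0" using c v1_0 by simp
  have "\<phi> q (\<lambda>h. 0) = (\<lambda>h. 0)"
    using endo_field_lincomb[OF \<phi> pq(3) v2 v2, of 0 0] by simp
  then have "(\<lambda>h. 0) = (\<lambda>h. - ?v2 h)" using sq \<phi>0 eta0 by simp
  then have v2_0: "?v2 = (\<lambda>h. 0)" by (metis (no_types) neg_equal_0_iff_equal)
  show ?thesis by (rule tangent_prod_eq_zero[OF z v v1_0 v2_0])
qed

text \<open>The test pair is chosen with the same projections as the difference of \<open>v\<close>
  and \<open>w\<close>. The metric sees nothing else, so the hypothesis says that the difference is
  a null vector.\<close>

lemma tangent_eqI:
  assumes ac: "almost_contact_metric M2 \<phi> \<xi> \<eta> g2" and f_pos: "\<forall>p\<in>points M1. f p > 0"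
    and pq: "p \<in> points M1" "q \<in> points M2"
    and v: "v \<in> tangent_space P (p, q)" and w: "w \<in> tangent_space P (p, q)"
    and eq: "\<And>Z W. Z \<in> vector_fields M1 \<Longrightarrow> W \<in> vector_fields M2 \<Longrightarrow>
      g (p, q) v (field_pair P Z W (p, q)) = g (p, q) w (field_pair P Z W (p, q))"
  shows "v = w"
proof -
  let ?d = "\<lambda>h. v h - w h"
  have z: "(p, q) \<in> points P" using pq by simp
  have d: "?d \<in> tangent_space P (p, q)" using P.tangent_space_lincomb[OF v w, of 1 "-1"] by simp
  have d1: "differential M1 fst ?d \<in> tangent_space M1 p" and d2: "differential M2 snd ?d \<in> tangent_space M2 q"
    using differential_fst_tangent[OF d] differential_snd_tangent[OF d] by simp_all
  obtain Z where Z: "Z \<in> vector_fields M1" "Z p = differential M1 fst ?d"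
    using M1.vector_field_through[OF pq(1) d1] .
  obtain W where W: "W \<in> vector_fields M2" "W q = differential M2 snd ?d"
    using M2.vector_field_through[OF pq(2) d2] .
  have "g (p, q) ?d ?d = g (p, q) ?d (field_pair P Z W (p, q))"
    using differential_fst_field_pair[OF Z(1) W(1) pq] differential_snd_field_pair[OF Z(1) W(1) pq]
    by (simp add: product_metric_def eta_bar_def Z(2) W(2))
  also have "\<dots> = 0"
    using symmetric_bilinear_diff[OF metric_symmetric_bilinear[OF z] v w
        P.vector_field_tangent[OF field_pair_vector_field[OF Z(1) W(1)] z]] eq[OF Z(1) W(1)] by simp
  finally have "?d = (\<lambda>h. 0)" by (rule metric_definite[OF ac f_pos z d])
  then have "v h - w h = 0" for h by (rule fun_cong)
  then show ?thesis by (simp add: fun_eq_iff)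
qed

end

section \<open>The three formulas at a point\<close>

theorem theorem4p2:
  fixes M1 :: "('a, 'e::euclidean_space) mfd" and M2 :: "('b, 'f::euclidean_space) mfd"
    and J :: "'a endo" and g1 :: "'a form2" and \<omega> :: "'a form1"
    and \<phi> :: "'b endo" and \<xi> :: "'b vfield" and \<eta> :: "'b form1" and g2 :: "'b form2"
    and \<alpha> :: real and f :: "'a \<Rightarrow> real"
    and M :: "('a \<times> 'b, 'e \<times> 'f) mfd" and \<eta>b :: "('a \<times> 'b) form1" and g :: "('a \<times> 'b) form2"
    and nabla1 :: "'a connection" and nabla2 :: "'b connection"
    and nabla :: "('a \<times> 'b) connection"
    and X Y :: "'a vfield" and U V W :: "'b vfield"
  assumes "almost_hermitian M1 J g1"
    and "one_form M1 \<omega>"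
    and "\<forall>X\<in>vector_fields M1. \<forall>Y\<in>vector_fields M1. \<forall>p\<in>points M1.
           ext_deriv M1 \<omega> X Y p = fundamental_form J g1 p (X p) (Y p)"
    and "almost_contact_metric M2 \<phi> \<xi> \<eta> g2"
    and "smooth_fun M1 f" and "\<forall>p\<in>points M1. f p > 0"
    and "M = prod_mfd M1 M2"
    and "\<eta>b = eta_bar M1 M2 \<alpha> \<omega> \<eta>"
    and "g = product_metric M1 M2 \<alpha> f \<omega> g1 \<eta> g2"
    and "levi_civita M1 g1 nabla1" and "levi_civita M2 g2 nabla2" and "levi_civita M g nabla"
    and "X \<in> vector_fields M1" and "Y \<in> vector_fields M1"
    and "U \<in> vector_fields M2" and "V \<in> vector_fields M2" and "W \<in> vector_fields M2"
  shows "\<forall>p\<in>points M1. \<forall>q\<in>points M2.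
     nabla (field_pair M X zero_field) (field_pair M Y zero_field) (p, q) =
       tangent_pair M (p, q)
         (\<lambda>h. nabla1 X Y p h - \<alpha>\<^sup>2 * \<omega> p (X p) * J p (Y p) h - \<alpha>\<^sup>2 * \<omega> p (Y p) * J p (X p) h)
         (\<lambda>h. \<alpha> * (- \<omega> p (nabla1 X Y p) + \<alpha>\<^sup>2 * \<omega> p (X p) * \<omega> p (J p (Y p))
                   + \<alpha>\<^sup>2 * \<omega> p (Y p) * \<omega> p (J p (X p)) + sym_deriv M1 \<omega> X Y p / 2) * \<xi> q h)
   \<and>
     g (p, q) (nabla (field_pair M X zero_field) (field_pair M zero_field U) (p, q))
              (field_pair M Y W (p, q)) =
       f p * X p f * g2 q (\<phi> q (U q)) (\<phi> q (W q))
       + \<alpha> * \<eta> q (U q) * ext_deriv M1 \<omega> X Y p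
       + \<alpha> * \<omega> p (X p) * ext_deriv M2 \<eta> U W q
   \<and>
     g (p, q) (nabla (field_pair M zero_field U) (field_pair M zero_field V) (p, q))
              (field_pair M Y W (p, q)) =
       (f p)\<^sup>2 * g2 q (nabla2 U V q) (W q)
       + (1 - (f p)\<^sup>2) * \<eta> q (V q) * ext_deriv M2 \<eta> U W q
       + (1 - (f p)\<^sup>2) * \<eta> q (U q) * ext_deriv M2 \<eta> V W q
       + sym_deriv M2 \<eta> U V q / 2 * \<eta>b (p, q) (field_pair M Y W (p, q))
       - sym_deriv M2 \<eta> U V q / 2 * (f p)\<^sup>2 * \<eta> q (W q)
       - f p * Y p f * g2 q (\<phi> q (U q)) (\<phi> q (V q))"
  unfolding assms(7,8,9)
proof (intro ballI conjI)
  fix p q assume pq: "p \<in> points M1" "q \<in> points M2"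
  note ah = assms(1) and omega = assms(2) and ac = assms(4)
  note J = almost_hermitianD(2)[OF ah] and rg1 = almost_hermitianD(3)[OF ah]
  note \<xi> = almost_contact_metricD(3)[OF ac] and eta = almost_contact_metricD(4)[OF ac]
    and rg2 = almost_contact_metricD(5)[OF ac] and \<eta>\<xi> = almost_contact_metricD(7)[OF ac pq(2)]
    and \<phi>g = almost_contact_metricD(8)[OF ac _ _ pq(2)]
  interpret two_atlases M1 M2
    by (rule two_atlases.intro[OF smooth_manifold_imp_hausdorff_atlas[OF almost_hermitianD(1)[OF ah]]
          smooth_manifold_imp_hausdorff_atlas[OF almost_contact_metricD(1)[OF ac]]])
  interpret S: product_structure M1 M2 \<alpha> f \<omega> g1 \<eta> g2
    by unfold_locales (rule omega rg1 eta rg2 assms(5))+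
  note X = assms(13) and Y = assms(14) and U = assms(15) and V = assms(16) and W = assms(17)
  note lc1 = assms(10) and lc2 = assms(11)
  have lc: "levi_civita P S.g nabla" using assms(7,9,12) by simp
  have z: "(p, q) \<in> points P" using pq by simp
  note O1 = M1.zero_field and O2 = M2.zero_field
  note T1 = M1.vector_field_tangent[OF _ pq(1)] and T2 = M2.vector_field_tangent[OF _ pq(2)]
  note b1 = riemannian_metric_symmetric_bilinear[OF rg1 pq(1)]
  note b2 = riemannian_metric_symmetric_bilinear[OF rg2 pq(2)]
  note b = S.metric_symmetric_bilinear[OF z]
  have zero_apply: "zero_field r h = 0" for r :: 'x and h by (simp add: zero_field_def)
  have const1: "A p (\<lambda>x. 0) = 0" if "A \<in> vector_fields M1" for A
    by (rule M1.tv_const[OF T1[OF that]])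
  have const2: "A q (\<lambda>x. 0) = 0" if "A \<in> vector_fields M2" for A
    by (rule M2.tv_const[OF T2[OF that]])
  \<comment> \<open>The form vanishes on \<open>zero_field\<close> by linearity at points of the
    carrier only, so the inner function is exchanged for the constant 0 by \<open>tv_cong\<close>;
    the same happens for \<eta> and both metrics below.\<close>
  have \<omega>0: "A p (\<lambda>x. \<omega> x (zero_field x)) = 0" if "A \<in> vector_fields M1" for A
  proof -
    have "A p (\<lambda>x. \<omega> x (zero_field x)) = A p (\<lambda>x. 0)"
      by (rule M1.tv_cong[OF T1[OF that] one_form_smooth[OF omega O1] pq(1)])
        (rule M1.one_form_zero_field[OF omega])
    then show ?thesis using const1[OF that] by simp
  qed
  have \<eta>0: "A q (\<lambda>x. \<eta> x (zero_field x)) = 0" if "A \<in> vector_fields M2" for A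
  proof -
    have "A q (\<lambda>x. \<eta> x (zero_field x)) = A q (\<lambda>x. 0)"
      by (rule M2.tv_cong[OF T2[OF that] one_form_smooth[OF eta O2] pq(2)])
        (rule M2.one_form_zero_field[OF eta])
    then show ?thesis using const2[OF that] by simp
  qed
  have g10: "A p (\<lambda>x. g1 x (zero_field x) (B x)) = 0" "A p (\<lambda>x. g1 x (B x) (zero_field x)) = 0"
    if "A \<in> vector_fields M1" "B \<in> vector_fields M1" for A B
  proof -
    have "A p (\<lambda>x. g1 x (zero_field x) (B x)) = A p (\<lambda>x. 0)"
      by (rule M1.tv_cong[OF T1[OF that(1)] riemannian_metric_smooth[OF rg1 O1 that(2)] pq(1)])
        (rule M1.metric_zero_field[OF rg1 _ M1.vector_field_tangent[OF that(2)]])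
    then show "A p (\<lambda>x. g1 x (zero_field x) (B x)) = 0" using const1[OF that(1)] by simp
    have "A p (\<lambda>x. g1 x (B x) (zero_field x)) = A p (\<lambda>x. 0)"
      by (rule M1.tv_cong[OF T1[OF that(1)] riemannian_metric_smooth[OF rg1 that(2) O1] pq(1)])
        (rule M1.metric_zero_field[OF rg1 _ M1.vector_field_tangent[OF that(2)]])
    then show "A p (\<lambda>x. g1 x (B x) (zero_field x)) = 0" using const1[OF that(1)] by simp
  qed
  have g20: "A q (\<lambda>x. g2 x (zero_field x) (B x)) = 0" "A q (\<lambda>x. g2 x (B x) (zero_field x)) = 0"
    if "A \<in> vector_fields M2" "B \<in> vector_fields M2" for A B
  proof -
    have "A q (\<lambda>x. g2 x (zero_field x) (B x)) = A q (\<lambda>x. 0)"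
      by (rule M2.tv_cong[OF T2[OF that(1)] riemannian_metric_smooth[OF rg2 O2 that(2)] pq(2)])
        (rule M2.metric_zero_field[OF rg2 _ M2.vector_field_tangent[OF that(2)]])
    then show "A q (\<lambda>x. g2 x (zero_field x) (B x)) = 0" using const2[OF that(1)] by simp
    have "A q (\<lambda>x. g2 x (B x) (zero_field x)) = A q (\<lambda>x. 0)"
      by (rule M2.tv_cong[OF T2[OF that(1)] riemannian_metric_smooth[OF rg2 that(2) O2] pq(2)])
        (rule M2.metric_zero_field[OF rg2 _ M2.vector_field_tangent[OF that(2)]])
    then show "A q (\<lambda>x. g2 x (B x) (zero_field x)) = 0" using const2[OF that(1)] by simp
  qed
  \<comment> \<open>Tangency of the bracket is read off torsion-freeness, as a difference of two
    tangent vectors, without computing with second derivatives.\<close>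
  have br1: "bracket M1 A B p \<in> tangent_space M1 p" if "A \<in> vector_fields M1" "B \<in> vector_fields M1" for A B
    using levi_civita_torsion_free[OF lc1 that pq(1)] M1.tangent_space_lincomb[of _ p _ 1 "-1"]
      T1[OF levi_civita_field[OF lc1 that]] T1[OF levi_civita_field[OF lc1 that(2,1)]] by simp
  have br2: "bracket M2 A B q \<in> tangent_space M2 q" if "A \<in> vector_fields M2" "B \<in> vector_fields M2" for A B
    using levi_civita_torsion_free[OF lc2 that pq(2)] M2.tangent_space_lincomb[of _ q _ 1 "-1"]
      T2[OF levi_civita_field[OF lc2 that]] T2[OF levi_civita_field[OF lc2 that(2,1)]] by simp
  note zeros = zero_apply \<omega>0 \<eta>0 g10 g20
    M1.one_form_zero_field[OF omega pq(1)] M2.one_form_zero_field[OF eta pq(2)]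
    M1.metric_zero_field[OF rg1 pq(1) T1] M2.metric_zero_field[OF rg2 pq(2) T2]
    M1.metric_zero_field[OF rg1 pq(1) br1] M2.metric_zero_field[OF rg2 pq(2) br2]
    M1.bracket_zero_left[OF _ pq(1)] M1.bracket_zero_right[OF _ pq(1)]
    M2.bracket_zero_left[OF _ pq(2)] M2.bracket_zero_right[OF _ pq(2)]
  note K = koszul[OF lc b field_pair_vector_field field_pair_vector_field field_pair_vector_field z]
  note K1 = koszul[OF lc1 b1 _ _ _ pq(1)] and K2 = koszul[OF lc2 b2 _ _ _ pq(2)]
  show "S.g (p, q) (nabla (field_pair P X zero_field) (field_pair P zero_field U) (p, q))
              (field_pair P Y W (p, q)) =
       f p * X p f * g2 q (\<phi> q (U q)) (\<phi> q (W q))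
       + \<alpha> * \<eta> q (U q) * ext_deriv M1 \<omega> X Y p
       + \<alpha> * \<omega> p (X p) * ext_deriv M2 \<eta> U W q"
    \<comment> \<open>Each term with \<open>g1\<close> or \<open>g2\<close> has a zero argument or a
      zero direction of differentiation, except the derivative of the squared \<open>f\<close> along
      \<open>X\<close>, which \<open>\<phi>g\<close> matches with the first summand. Hence neither
      factor's connection appears.\<close>
    using K[OF X O2 O1 U Y W]
    by (simp add: S.metric_derivative S.metric_bracket_field_pair X Y U W O1 O2 pq zeros
        \<phi>g ext_deriv_def field_simps)
  show "S.g (p, q) (nabla (field_pair P zero_field U) (field_pair P zero_field V) (p, q))
              (field_pair P Y W (p, q)) =
       (f p)\<^sup>2 * g2 q (nabla2 U V q) (W q)
       + (1 - (f p)\<^sup>2) * \<eta> q (V q) * ext_deriv M2 \<eta> U W q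
       + (1 - (f p)\<^sup>2) * \<eta> q (U q) * ext_deriv M2 \<eta> V W q
       + sym_deriv M2 \<eta> U V q / 2 * eta_bar M1 M2 \<alpha> \<omega> \<eta> (p, q) (field_pair P Y W (p, q))
       - sym_deriv M2 \<eta> U V q / 2 * (f p)\<^sup>2 * \<eta> q (W q)
       - f p * Y p f * g2 q (\<phi> q (U q)) (\<phi> q (V q))"
  proof -
    have eb: "eta_bar M1 M2 \<alpha> \<omega> \<eta> (p, q) (field_pair P Y W (p, q)) = \<alpha> * \<omega> p (Y p) + \<eta> q (W q)"
      using differential_fst_field_pair[OF Y W pq] differential_snd_field_pair[OF Y W pq]
      by (simp add: eta_bar_def)
    show ?thesis
      unfolding eb
      \<comment> \<open>The Koszul formula of \<open>M2\<close> is scaled by the squared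
        \<open>f\<close>, the weight of \<open>g2\<close> in the product metric, so that its terms
        cancel linearly.\<close>
      using K[OF O1 U O1 V Y W] arg_cong[OF K2[OF U V W], of "\<lambda>t. (f p)\<^sup>2 * t"]
      by (simp add: S.metric_derivative S.metric_bracket_field_pair Y U V W O1 O2 pq zeros
          \<phi>g ext_deriv_def sym_deriv_def field_simps)
  qed
  let ?T = "\<lambda>h. nabla1 X Y p h - \<alpha>\<^sup>2 * \<omega> p (X p) * J p (Y p) h - \<alpha>\<^sup>2 * \<omega> p (Y p) * J p (X p) h"
  \<comment> \<open>This is the number for which \<alpha> \<omega>(T) + c = \<alpha> \<lambda>/2,
    the value that \<open>eta_bar\<close> must take on the covariant derivative.\<close>
  define c where "c = \<alpha> * (- \<omega> p (nabla1 X Y p) + \<alpha>\<^sup>2 * \<omega> p (X p) * \<omega> p (J p (Y p))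
                 + \<alpha>\<^sup>2 * \<omega> p (Y p) * \<omega> p (J p (X p)) + sym_deriv M1 \<omega> X Y p / 2)"
  have n: "nabla1 X Y p \<in> tangent_space M1 p" by (rule T1[OF levi_civita_field[OF lc1 X Y]])
  have JX: "J p (X p) \<in> tangent_space M1 p" by (rule T1[OF endo_field_field[OF J X]])
  have JY: "J p (Y p) \<in> tangent_space M1 p" by (rule T1[OF endo_field_field[OF J Y]])
  \<comment> \<open>The linearity rules are binary with explicit coefficients, so \<open>?T\<close>
    is assembled from two nested combinations, the coefficient 1 being written out.\<close>
  let ?T' = "\<lambda>h. 1 * nabla1 X Y p h + (- (\<alpha>\<^sup>2 * \<omega> p (X p))) * J p (Y p) h"
  have T': "?T' \<in> tangent_space M1 p" by (rule M1.tangent_space_lincomb[OF n JY])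
  have T_eq: "?T = (\<lambda>h. 1 * ?T' h + (- (\<alpha>\<^sup>2 * \<omega> p (Y p))) * J p (X p) h)" by (simp add: algebra_simps)
  have T: "?T \<in> tangent_space M1 p" unfolding T_eq by (rule M1.tangent_space_lincomb[OF T' JX])
  have \<omega>T: "\<omega> p ?T = \<omega> p (nabla1 X Y p) - \<alpha>\<^sup>2 * \<omega> p (X p) * \<omega> p (J p (Y p)) - \<alpha>\<^sup>2 * \<omega> p (Y p) * \<omega> p (J p (X p))"
    unfolding T_eq
    by (simp only: one_form_lincomb[OF omega pq(1) T' JX] one_form_lincomb[OF omega pq(1) n JY]) simp
  have \<xi>q: "\<xi> q \<in> tangent_space M2 q" by (rule T2[OF \<xi>])
  have c\<xi>: "(\<lambda>h. c * \<xi> q h) \<in> tangent_space M2 q"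
    using M2.tangent_space_lincomb[OF \<xi>q \<xi>q, of c 0] by simp
  have \<eta>c\<xi>: "\<eta> q (\<lambda>h. c * \<xi> q h) = c"
    using one_form_lincomb[OF eta pq(2) \<xi>q \<xi>q, of c 0] \<eta>\<xi> by simp
  have "nabla (field_pair P X zero_field) (field_pair P Y zero_field) (p, q) =
      tangent_pair P (p, q) ?T (\<lambda>h. c * \<xi> q h)"
  proof (rule S.tangent_eqI[OF ac assms(6) pq])
    show "nabla (field_pair P X zero_field) (field_pair P Y zero_field) (p, q) \<in> tangent_space P (p, q)"
      by (rule P.vector_field_tangent[OF levi_civita_field[OF lc field_pair_vector_field[OF X O2]
              field_pair_vector_field[OF Y O2]] z])
    show "tangent_pair P (p, q) ?T (\<lambda>h. c * \<xi> q h) \<in> tangent_space P (p, q)"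
      by (rule tangent_pair_tangent[OF pq T c\<xi>])
    fix Z W' assume Z: "Z \<in> vector_fields M1" and W': "W' \<in> vector_fields M2"
    have Zp: "Z p \<in> tangent_space M1 p" and Wq: "W' q \<in> tangent_space M2 q" using T1[OF Z] T2[OF W'] .
    have gT: "g1 p ?T (Z p) = g1 p (nabla1 X Y p) (Z p)
        - \<alpha>\<^sup>2 * \<omega> p (X p) * g1 p (J p (Y p)) (Z p) - \<alpha>\<^sup>2 * \<omega> p (Y p) * g1 p (J p (X p)) (Z p)"
      unfolding T_eq
      by (simp only: symmetric_bilinear_lincomb[OF b1 T' JX Zp] symmetric_bilinear_lincomb[OF b1 n JY Zp]) simp
    have g\<xi>: "g2 q (\<lambda>h. c * \<xi> q h) (W' q) = c * \<eta> q (W' q)"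
      using symmetric_bilinear_lincomb[OF b2 \<xi>q \<xi>q Wq, of c 0] almost_contact_metric_xi[OF ac pq(2) W']
      by simp
    have JZ: "g1 p (J p (A p)) (Z p) = - ext_deriv M1 \<omega> A Z p" if "A \<in> vector_fields M1" for A
      using almost_hermitian_skew[OF ah that Z pq(1)] assms(3) that Z pq(1)
      by (simp add: fundamental_form_def)
    \<comment> \<open>The term weighted by the squared \<open>f\<close> cancels, because \<xi> is
      dual to \<eta> under \<open>g2\<close> and \<eta>(c \<xi>) = c.\<close>
    have "S.g (p, q) (tangent_pair P (p, q) ?T (\<lambda>h. c * \<xi> q h)) (field_pair P Z W' (p, q)) =
        g1 p (nabla1 X Y p) (Z p) + \<alpha>\<^sup>2 * \<omega> p (X p) * ext_deriv M1 \<omega> Y Z p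
        + \<alpha>\<^sup>2 * \<omega> p (Y p) * ext_deriv M1 \<omega> X Z p
        + \<alpha> * (sym_deriv M1 \<omega> X Y p / 2) * (\<alpha> * \<omega> p (Z p) + \<eta> q (W' q))"
      unfolding field_pair_def fst_conv snd_conv S.metric_tangent_pair[OF pq T Zp c\<xi> Wq]
        gT g\<xi> \<eta>c\<xi> \<omega>T JZ[OF X] JZ[OF Y]
      by (simp add: c_def field_simps)
    moreover have "S.g (p, q) (nabla (field_pair P X zero_field) (field_pair P Y zero_field) (p, q))
        (field_pair P Z W' (p, q)) =
        g1 p (nabla1 X Y p) (Z p) + \<alpha>\<^sup>2 * \<omega> p (X p) * ext_deriv M1 \<omega> Y Z p
        + \<alpha>\<^sup>2 * \<omega> p (Y p) * ext_deriv M1 \<omega> X Z p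
        + \<alpha> * (sym_deriv M1 \<omega> X Y p / 2) * (\<alpha> * \<omega> p (Z p) + \<eta> q (W' q))"
      \<comment> \<open>The formula of \<open>M1\<close> accounts for the terms with
        \<open>g1\<close>. The products of \<open>eta_bar\<close> leave \<omega>(X) paired with
        d\<omega>(Y, Z), \<omega>(Y) with d\<omega>(X, Z), and \<lambda> with \<open>eta_bar\<close>
        of (Z, W').\<close>
      using K[OF X O2 Y O2 Z W'] K1[OF X Y Z]
      by (simp add: S.metric_derivative S.metric_bracket_field_pair X Y Z W' O1 O2 pq zeros
          ext_deriv_def sym_deriv_def field_simps power2_eq_square)
    ultimately show "S.g (p, q) (nabla (field_pair P X zero_field) (field_pair P Y zero_field) (p, q))
        (field_pair P Z W' (p, q)) =
        S.g (p, q) (tangent_pair P (p, q) ?T (\<lambda>h. c * \<xi> q h)) (field_pair P Z W' (p, q))"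
      by simp
  qed
  then show "nabla (field_pair P X zero_field) (field_pair P Y zero_field) (p, q) =
     tangent_pair P (p, q) ?T
       (\<lambda>h. \<alpha> * (- \<omega> p (nabla1 X Y p) + \<alpha>\<^sup>2 * \<omega> p (X p) * \<omega> p (J p (Y p))
                 + \<alpha>\<^sup>2 * \<omega> p (Y p) * \<omega> p (J p (X p)) + sym_deriv M1 \<omega> X Y p / 2) * \<xi> q h)"
    unfolding c_def .
qed

end
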